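(* Let $\mathcal{M}$ be a set of probability measures on a measurable space $(\Omega,\mathcal{F})$, let $\mathcal{H}$ be the space of bounded $\mathcal{F}$-measurable real functions on $\Omega$ with the supremum-norm topology $\tau$, and let the pre-order be the quasi-sure order: $X\le Y$ if and only if $\mathbb{P}(X\le Y)=1$ for all $\mathbb{P}\in\mathcal{M}$. Let $$\mathcal{R}=\{R\in\mathcal{H}: 0\le R\ \text{ and there exists }\mathbb{P}\in\mathcal{M}\text{ such that }\mathbb{P}(R>0)>0\},$$ and let $\mathcal{I}\subset\mathcal{H}$ be the linear subspace of net trades of a frictionless finite-horizon discrete-time financial market (see context). Then the financial market $(\mathcal{H},\tau,\le,\mathcal{I},\mathcal{R})$ is viable if and only if there is a set $\mathcal{Q}$ of finitely additive martingale measures that has the same polar sets as $\mathcal{M}$.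
   Context: Polar sets: for a set $\mathcal{N}$ of (finitely additive) probability measures on $(\Omega,\mathcal{F})$, an event $A\in\mathcal{F}$ is $\mathcal{N}$-polar if $\nu(A)=0$ for every $\nu\in\mathcal{N}$. Net trades: there are a filtration $(\mathcal{F}_t)_{t=0}^T$ on $(\Omega,\mathcal{F})$ ($T\ge1$), an adapted $\mathbb{R}^J_+$-valued process $S=(S_t)_{t=0}^T$ (discounted prices, with a riskless bond with interest rate zero), and $\mathcal{I}$ is the set of $\ell\in\mathcal{H}$ of the form $\ell=\sum_{t=1}^T H_t\cdot(S_t-S_{t-1})$ with $H_t$ an $\mathcal{F}_{t-1}$-measurable $\mathbb{R}^J$-valued function; $\mathcal{I}$ is a linear subspace of $\mathcal{H}$. Agents: $\mathcal{A}$ is the set of complete and transitive binary relations $\preceq$ on $\mathcal{H}$ (with strict part $\prec$) that are (i) weakly monotone: $X\le Y$ implies $X\preceq Y$; (ii) convex: $\{Z\in\mathcal{H}: X\preceq Z\}$ is convex for every $X$; (iii) $\tau$-lower semi-continuous: if $X_n\to X$ in $\tau$ and $X_n\preceq Y$ for all $n$, then $X\preceq Y$. Viability: the market is viable if there is a family $\{\preceq_a\}_{a\in A}\subset\mathcal{A}$ such that $\ell\preceq_a 0$ for every $a\in A$ and $\ell\in\mathcal{I}$, and for every $R\in\mathcal{R}$ there is $a\in A$ with $0\prec_a R$. Finitely additive martingale measure: a finitely additive probability measure $\phi$ on $(\Omega,\mathcal{F})$ with $\int\ell\,d\phi=0$ for all $\ell\in\mathcal{I}$. *)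

theory Defs
  imports "HOL-Probability.Probability"
begin

text \<open>
  A measurable space is given by \<^term>\<open>space F\<close> and \<^term>\<open>sets F\<close> for some \<open>F :: 'w measure\<close>; the
  measure that \<open>F\<close> carries is never used.

  A function on \<^term>\<open>space F\<close> is represented by its extension by zero. This makes elements of
  \<open>bounded_measurable F\<close> correspond one-to-one to bounded measurable functions on \<^term>\<open>space F\<close>
  and keeps the set closed under pointwise linear operations.
\<close>

definition bounded_measurable :: "'w measure \<Rightarrow> ('w \<Rightarrow> real) set" where
  "bounded_measurable F =
     {X. X \<in> borel_measurable F \<and> bounded (X ` space F) \<and> (\<forall>\<omega>. \<omega> \<notin> space F \<longrightarrow> X \<omega> = 0)}"

text \<open>
  The guard matters only for \<open>Metric_space\<close>, which requires the distance to be nonnegative also off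
  the carrier.
\<close>

definition sup_dist :: "'w measure \<Rightarrow> ('w \<Rightarrow> real) \<Rightarrow> ('w \<Rightarrow> real) \<Rightarrow> real" where
  "sup_dist F X Y =
     (if space F \<noteq> {} \<and> X \<in> bounded_measurable F \<and> Y \<in> bounded_measurable F
      then SUP \<omega>\<in>space F. \<bar>X \<omega> - Y \<omega>\<bar> else 0)"

definition sup_topology :: "'w measure \<Rightarrow> ('w \<Rightarrow> real) topology" where
  "sup_topology F = Metric_space.mtopology (bounded_measurable F) (sup_dist F)"

definition qs_le :: "'w measure set \<Rightarrow> ('w \<Rightarrow> real) \<Rightarrow> ('w \<Rightarrow> real) \<Rightarrow> bool" where
  "qs_le M X Y \<longleftrightarrow> (\<forall>P\<in>M. measure P {\<omega>\<in>space P. X \<omega> \<le> Y \<omega>} = 1)"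

definition relevant_contracts :: "'w measure \<Rightarrow> 'w measure set \<Rightarrow> ('w \<Rightarrow> real) set" where
  "relevant_contracts F M =
     {R \<in> bounded_measurable F.
        qs_le M (\<lambda>_. 0) R \<and> (\<exists>P\<in>M. measure P {\<omega>\<in>space P. R \<omega> > 0} > 0)}"

definition net_trades ::
    "'w measure \<Rightarrow> nat \<Rightarrow> (nat \<Rightarrow> 'w measure) \<Rightarrow> (nat \<Rightarrow> 'w \<Rightarrow> real ^ 'j) \<Rightarrow> ('w \<Rightarrow> real) set" where
  "net_trades F T Fil S =
     {l \<in> bounded_measurable F.
        \<exists>H :: nat \<Rightarrow> 'w \<Rightarrow> real ^ 'j.
          (\<forall>t\<in>{1..T}. H t \<in> borel_measurable (Fil (t - 1))) \<and>
          (\<forall>\<omega>\<in>space F. l \<omega> = (\<Sum>t=1..T. H t \<omega> \<bullet> (S t \<omega> - S (t - 1) \<omega>)))}"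

text \<open>
  In the following three definitions a market is a tuple \<open>(H, \<tau>, le, I, R)\<close>, and a pair \<open>(X, Y)\<close> in a
  preference relation means that \<open>Y\<close> is weakly preferred to \<open>X\<close>. Functions into the reals are not an
  instance of class \<open>real_vector\<close>, so convexity is written out in \<open>convex_funs\<close>.
\<close>

definition convex_funs :: "('w \<Rightarrow> real) set \<Rightarrow> bool" where
  "convex_funs C \<longleftrightarrow>
     (\<forall>Y\<in>C. \<forall>Z\<in>C. \<forall>u. 0 \<le> u \<and> u \<le> 1 \<longrightarrow> (\<lambda>\<omega>. (1 - u) * Y \<omega> + u * Z \<omega>) \<in> C)"

definition agents ::
    "('w \<Rightarrow> real) set \<Rightarrow> ('w \<Rightarrow> real) topology \<Rightarrow> (('w \<Rightarrow> real) \<Rightarrow> ('w \<Rightarrow> real) \<Rightarrow> bool) \<Rightarrow>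
     ('w \<Rightarrow> real) rel set" where
  "agents H \<tau> le =
     {r. r \<subseteq> H \<times> H \<and>
         (\<forall>X\<in>H. \<forall>Y\<in>H. (X, Y) \<in> r \<or> (Y, X) \<in> r) \<and>
         trans r \<and>
         (\<forall>X\<in>H. \<forall>Y\<in>H. le X Y \<longrightarrow> (X, Y) \<in> r) \<and>
         (\<forall>X\<in>H. convex_funs {Z\<in>H. (X, Z) \<in> r}) \<and>
         (\<forall>Xn X Y. (\<forall>n. Xn n \<in> H) \<and> X \<in> H \<and> Y \<in> H \<and>
            limitin \<tau> Xn X sequentially \<and> (\<forall>n. (Xn n, Y) \<in> r) \<longrightarrow> (X, Y) \<in> r)}"

definition viable ::
    "('w \<Rightarrow> real) set \<Rightarrow> ('w \<Rightarrow> real) topology \<Rightarrow> (('w \<Rightarrow> real) \<Rightarrow> ('w \<Rightarrow> real) \<Rightarrow> bool) \<Rightarrow>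
     ('w \<Rightarrow> real) set \<Rightarrow> ('w \<Rightarrow> real) set \<Rightarrow> bool" where
  "viable H \<tau> le I Rel \<longleftrightarrow>
     (\<exists>U\<subseteq>agents H \<tau> le.
        (\<forall>r\<in>U. \<forall>l\<in>I. (l, \<lambda>_. 0) \<in> r) \<and>
        (\<forall>R\<in>Rel. \<exists>r\<in>U. (\<lambda>_. 0, R) \<in> r \<and> (R, \<lambda>_. 0) \<notin> r))"

text \<open>Only the values of a set function on \<^term>\<open>sets F\<close> are constrained or used.\<close>

definition fa_prob :: "'w measure \<Rightarrow> ('w set \<Rightarrow> real) \<Rightarrow> bool" where
  "fa_prob F \<phi> \<longleftrightarrow>
     (\<forall>A\<in>sets F. 0 \<le> \<phi> A) \<and> additive (sets F) \<phi> \<and> \<phi> (space F) = 1"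

definition simple_fa_integral :: "'w measure \<Rightarrow> ('w set \<Rightarrow> real) \<Rightarrow> ('w \<Rightarrow> real) \<Rightarrow> real" where
  "simple_fa_integral F \<phi> g = (\<Sum>y\<in>g ` space F. y * \<phi> (g -` {y} \<inter> space F))"

text \<open>
  A bounded measurable function is a uniform limit of simple functions, so for a finitely additive
  probability the supremum below is the usual integral of such a function (for other functions the
  value has no meaning).
\<close>

definition fa_integral :: "'w measure \<Rightarrow> ('w set \<Rightarrow> real) \<Rightarrow> ('w \<Rightarrow> real) \<Rightarrow> real" where
  "fa_integral F \<phi> X =
     (SUP g \<in> {g. simple_function F g \<and> (\<forall>\<omega>\<in>space F. g \<omega> \<le> X \<omega>)}. simple_fa_integral F \<phi> g)"

definition fa_martingale_measures ::
    "'w measure \<Rightarrow> ('w \<Rightarrow> real) set \<Rightarrow> ('w set \<Rightarrow> real) set" where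
  "fa_martingale_measures F I = {\<phi>. fa_prob F \<phi> \<and> (\<forall>l\<in>I. fa_integral F \<phi> l = 0)}"

definition polar_sets :: "'w measure \<Rightarrow> ('w set \<Rightarrow> real) set \<Rightarrow> 'w set set" where
  "polar_sets F N = {A \<in> sets F. \<forall>\<nu>\<in>N. \<nu> A = 0}"

lemma bdd_above_diff:
  assumes "X \<in> bounded_measurable F" "Y \<in> bounded_measurable F"
  shows "bdd_above ((\<lambda>\<omega>. \<bar>X \<omega> - Y \<omega>\<bar>) ` space F)"
proof -
  obtain a b where ab: "\<forall>\<omega>\<in>space F. \<bar>X \<omega>\<bar> \<le> a" "\<forall>\<omega>\<in>space F. \<bar>Y \<omega>\<bar> \<le> b"
    using assms unfolding bounded_measurable_def bounded_iff by auto
  have "\<bar>X \<omega> - Y \<omega>\<bar> \<le> a + b" if "\<omega> \<in> space F" for \<omega>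
    using ab that by (intro order_trans[OF abs_triangle_ineq4] add_mono) auto
  then show ?thesis by (auto intro!: bdd_aboveI[where M = "a + b"])
qed

lemma sup_dist_le_iff:
  assumes "X \<in> bounded_measurable F" "Y \<in> bounded_measurable F" "0 \<le> c"
  shows "sup_dist F X Y \<le> c \<longleftrightarrow> (\<forall>\<omega>\<in>space F. \<bar>X \<omega> - Y \<omega>\<bar> \<le> c)"
proof (cases "space F = {}")
  case False
  then show ?thesis
    using assms cSUP_le_iff[OF False bdd_above_diff[OF assms(1,2)]] by (simp add: sup_dist_def)
qed (simp add: sup_dist_def assms)

lemma sup_dist_nonneg: "0 \<le> sup_dist F X Y"
proof (cases "space F \<noteq> {} \<and> X \<in> bounded_measurable F \<and> Y \<in> bounded_measurable F")
  case True
  then obtain \<omega> where \<omega>: "\<omega> \<in> space F" by blast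
  have "\<bar>X \<omega> - Y \<omega>\<bar> \<le> (SUP \<omega>\<in>space F. \<bar>X \<omega> - Y \<omega>\<bar>)"
    using \<omega> True by (intro cSUP_upper bdd_above_diff) auto
  then show ?thesis using True unfolding sup_dist_def by simp
next
  case False
  then show ?thesis by (auto simp: sup_dist_def)
qed

lemma sup_dist_upper:
  assumes "X \<in> bounded_measurable F" "Y \<in> bounded_measurable F" "\<omega> \<in> space F"
  shows "\<bar>X \<omega> - Y \<omega>\<bar> \<le> sup_dist F X Y"
  using sup_dist_le_iff[OF assms(1,2) sup_dist_nonneg, of F X Y] assms(3) by simp

lemma Metric_space_sup_dist: "Metric_space (bounded_measurable F) (sup_dist F)"
proof
  fix X Y :: "'a \<Rightarrow> real"
  show "0 \<le> sup_dist F X Y" by (rule sup_dist_nonneg)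
  have "(\<lambda>\<omega>. \<bar>X \<omega> - Y \<omega>\<bar>) = (\<lambda>\<omega>. \<bar>Y \<omega> - X \<omega>\<bar>)"
    by (rule ext) (rule abs_minus_commute)
  then show "sup_dist F X Y = sup_dist F Y X"
    unfolding sup_dist_def by (simp only: conj_commute)
next
  fix X Y :: "'a \<Rightarrow> real"
  assume XY: "X \<in> bounded_measurable F" "Y \<in> bounded_measurable F"
  have "sup_dist F X Y = 0 \<longleftrightarrow> (\<forall>\<omega>\<in>space F. X \<omega> = Y \<omega>)"
  proof -
    have "sup_dist F X Y = 0 \<longleftrightarrow> sup_dist F X Y \<le> 0"
      using sup_dist_nonneg[of F X Y] by linarith
    then show ?thesis using sup_dist_le_iff[OF XY order.refl] by simp
  qed
  also have "\<dots> \<longleftrightarrow> X = Y"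
  proof
    assume eq: "\<forall>\<omega>\<in>space F. X \<omega> = Y \<omega>"
    show "X = Y"
    proof
      fix \<omega>
      show "X \<omega> = Y \<omega>"
        using eq XY by (cases "\<omega> \<in> space F") (auto simp: bounded_measurable_def)
    qed
  qed simp
  finally show "sup_dist F X Y = 0 \<longleftrightarrow> X = Y" .
next
  fix X Y Z :: "'a \<Rightarrow> real"
  assume XYZ: "X \<in> bounded_measurable F" "Y \<in> bounded_measurable F" "Z \<in> bounded_measurable F"
  have "\<bar>X \<omega> - Z \<omega>\<bar> \<le> sup_dist F X Y + sup_dist F Y Z" if "\<omega> \<in> space F" for \<omega>
    using sup_dist_upper[OF XYZ(1,2) that] sup_dist_upper[OF XYZ(2,3) that] by linarith
  then show "sup_dist F X Z \<le> sup_dist F X Y + sup_dist F Y Z"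
    using sup_dist_le_iff[OF XYZ(1,3) add_nonneg_nonneg[OF sup_dist_nonneg sup_dist_nonneg]]
    by blast
qed

lemma limitin_sup_topology_iff:
  assumes "\<And>n. Xn n \<in> bounded_measurable F" "X \<in> bounded_measurable F"
  shows "limitin (sup_topology F) Xn X sequentially \<longleftrightarrow> uniform_limit (space F) Xn X sequentially"
proof -
  interpret Metric_space "bounded_measurable F" "sup_dist F" by (rule Metric_space_sup_dist)
  have "limitin (sup_topology F) Xn X sequentially \<longleftrightarrow>
      (\<forall>e>0. \<forall>\<^sub>F n in sequentially. sup_dist F (Xn n) X < e)"
    unfolding sup_topology_def limitin_metric using assms by simp
  also have "\<dots> \<longleftrightarrow> (\<forall>e>0. \<forall>\<^sub>F n in sequentially. \<forall>\<omega>\<in>space F. dist (Xn n \<omega>) (X \<omega>) < e)"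
  proof (intro iffI allI impI)
    fix e :: real
    assume "\<forall>e>0. \<forall>\<^sub>F n in sequentially. sup_dist F (Xn n) X < e" "e > 0"
    then have "\<forall>\<^sub>F n in sequentially. sup_dist F (Xn n) X < e" by blast
    then show "\<forall>\<^sub>F n in sequentially. \<forall>\<omega>\<in>space F. dist (Xn n \<omega>) (X \<omega>) < e"
    proof eventually_elim
      case (elim n)
      show ?case
      proof
        fix \<omega> assume "\<omega> \<in> space F"
        from sup_dist_upper[OF assms(1)[of n] assms(2) this] elim
        show "dist (Xn n \<omega>) (X \<omega>) < e" unfolding dist_real_def by linarith
      qed
    qed
  next
    fix e :: real
    assume *: "\<forall>e>0. \<forall>\<^sub>F n in sequentially. \<forall>\<omega>\<in>space F. dist (Xn n \<omega>) (X \<omega>) < e" and e: "e > 0"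
    then have "\<forall>\<^sub>F n in sequentially. \<forall>\<omega>\<in>space F. dist (Xn n \<omega>) (X \<omega>) < e / 2"
      using half_gt_zero by blast
    then show "\<forall>\<^sub>F n in sequentially. sup_dist F (Xn n) X < e"
    proof eventually_elim
      case (elim n)
      then have "sup_dist F (Xn n) X \<le> e / 2"
        using e by (subst sup_dist_le_iff[OF assms(1) assms(2)]) (auto simp: dist_real_def less_imp_le)
      then show ?case using e by linarith
    qed
  qed
  finally show ?thesis by (simp add: uniform_limit_iff)
qed

end

theory Submission
  imports Defs "HOL-Library.Function_Algebras"
begin

text \<open>
  For an agent \<open>a\<close>, consider the net trades and the contracts that \<open>a\<close> strictly prefers to \<open>0\<close>. The
  two sets generate a convex cone \<open>K\<close> that avoids \<open>0\<close>, and by lower semicontinuity a relevant contract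
  \<open>R\<close> that \<open>a\<close> strictly prefers to \<open>0\<close> is an order unit of \<open>K\<close>. The gauge
  \<open>p(X) = inf {t. t R - X \<in> K}\<close> therefore dominates a linear functional \<open>f\<close>, and \<open>f R = 1\<close> and
  \<open>f \<ge> 0\<close> on \<open>K\<close>. Monotonicity makes \<open>f\<close> positive and blind to polar sets, and \<open>f\<close> vanishes on the
  subspace of net trades; normalized, it is integration against a finitely additive martingale
  measure that charges \<open>R\<close>. Conversely, each finitely additive martingale measure is the agent who
  ranks contracts by expected value.
\<close>

section \<open>Dominated linear functionals\<close>

text \<open>The martingale measures are only finitely additive, so no step may use their continuity
  along sequences of events. From viability to measures the separation is purely algebraic. The
  point 0 is not in \<open>K\<close> because \<open>0 = t Z + l\<close> would make \<open>Z\<close>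
  itself a net trade, and no net trade is strictly preferred to 0. Lower semicontinuity enters once:
  if \<open>R\<close> is strictly preferred to 0, so is \<open>R - X / n\<close> for large
  \<open>n\<close>, which makes \<open>R\<close> an algebraic interior point of \<open>K\<close>.
  Polar sets are null because for polar \<open>B\<close> both the indicator of \<open>B\<close> and
  its negative are quasi-surely nonnegative. In the other direction the obstacle is that a finitely
  additive \<phi> can charge \<open>{R > 0}\<close> and still integrate \<open>R\<close> to 0. Hence
  a level \<open>e > 0\<close> with \<open>{R >= e}\<close> not polar is first extracted from a
  countably additive \<open>P\<close>, and only then is \<phi> chosen, to charge that event. The
  choice of \<phi> depends on \<open>R\<close>, which is why a whole family of agents is
  used.\<close>

definition sublinear_on :: "(real \<Rightarrow> 'b::ab_group_add \<Rightarrow> 'b) \<Rightarrow> 'b set \<Rightarrow> ('b \<Rightarrow> real) \<Rightarrow> bool" where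
  "sublinear_on sc V q \<longleftrightarrow>
     (\<forall>x\<in>V. \<forall>y\<in>V. q (x + y) \<le> q x + q y) \<and> (\<forall>c>0. \<forall>x\<in>V. q (sc c x) \<le> c * q x)"

text \<open>Scalar multiplication and carrier are parameters, so the separation argument can be run
  abstractly and then instantiated with \<open>fun_scale\<close> and
  \<open>bounded_measurable F\<close>.\<close>

definition functional_on :: "(real \<Rightarrow> 'b::ab_group_add \<Rightarrow> 'b) \<Rightarrow> 'b set \<Rightarrow> ('b \<Rightarrow> real) \<Rightarrow> bool" where
  "functional_on sc V f \<longleftrightarrow>
     (\<forall>x\<in>V. \<forall>y\<in>V. f (x + y) = f x + f y) \<and> (\<forall>c. \<forall>x\<in>V. f (sc c x) = c * f x)"

section \<open>Sublinear functions, their infima, and minimal ones\<close>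

lemma sublinear_on_scale:
  assumes "vector_space sc" "module.subspace sc V" "sublinear_on sc V q" "c > 0" "x \<in> V"
  shows "q (sc c x) = c * q x"
proof (rule antisym)
  interpret vector_space sc by fact
  show "q (sc c x) \<le> c * q x" using assms by (simp add: sublinear_on_def)
  \<comment> \<open>Scaling back by \<open>inverse c\<close> reverses the inequality; this is why
    \<open>sublinear_on\<close> can ask for one half of positive homogeneity, the half that is
    convenient to check for infima.\<close>
  have "q (sc (inverse c) (sc c x)) \<le> inverse c * q (sc c x)"
    using assms(3,4) subspace_scale[OF assms(2,5)] unfolding sublinear_on_def
    by (meson positive_imp_inverse_positive)
  then show "c * q x \<le> q (sc c x)" using \<open>c > 0\<close> by (simp add: field_simps)
qed

lemma sublinear_on_zero:
  assumes "vector_space sc" "module.subspace sc V" "sublinear_on sc V q"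
  shows "q 0 = 0"
proof -
  interpret vector_space sc by fact
  show ?thesis
    using sublinear_on_scale[OF assms, of 2 0] subspace_0[OF assms(2)] by simp
qed

lemma sublinear_on_lower:
  assumes "vector_space sc" "module.subspace sc V" "sublinear_on sc V q" "x \<in> V"
  shows "- q (- x) \<le> q x"
proof -
  interpret vector_space sc by fact
  have "q (x + - x) \<le> q x + q (- x)"
    using assms(3,4) subspace_neg[OF assms(2,4)] unfolding sublinear_on_def by blast
  then show ?thesis using sublinear_on_zero[OF assms(1-3)] by simp
qed

text \<open>Additivity together with \<open>q 0 = 0\<close> makes \<open>q\<close> odd, and oddness
  carries positive homogeneity over to negative scalars.\<close>

lemma functional_on_if_superadditive:
  assumes vs: "vector_space sc" "module.subspace sc V" and q: "sublinear_on sc V q"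
    and super: "\<And>x y. x \<in> V \<Longrightarrow> y \<in> V \<Longrightarrow> q x + q y \<le> q (x + y)"
  shows "functional_on sc V q"
proof -
  interpret vector_space sc by fact
  have add: "q (x + y) = q x + q y" if "x \<in> V" "y \<in> V" for x y
    using super[OF that] q that by (force simp: sublinear_on_def)
  have neg: "q (- x) = - q x" if "x \<in> V" for x
    using add[OF that subspace_neg[OF vs(2) that]] sublinear_on_zero[OF vs q] by simp
  have "q (sc c x) = c * q x" if x: "x \<in> V" for c x
  proof (cases c "0::real" rule: linorder_cases)
    case less
    have "q (sc c x) = - q (sc (- c) x)"
      using neg[OF subspace_scale[OF vs(2) x], of "- c"] by simp
    also have "\<dots> = c * q x"
      using sublinear_on_scale[OF vs q, of "- c" x] less x by simp
    finally show ?thesis .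
  next
    case equal
    then show ?thesis using sublinear_on_zero[OF vs q] by simp
  next
    case greater
    then show ?thesis using sublinear_on_scale[OF vs q _ x] by simp
  qed
  with add show ?thesis by (simp add: functional_on_def)
qed

text \<open>The bound at \<open>t = 0\<close> says that \<open>u\<close> lies below
  \<open>q\<close>, the one at \<open>t = 1\<close> that \<open>u x <= q (x + y) - q y\<close>. If
  \<open>q\<close> is minimal, then \<open>u = q\<close>, and the second bound becomes
  superadditivity.\<close>

lemma sublinear_on_INF_directional:
  assumes vs: "vector_space sc" "module.subspace sc V" and q: "sublinear_on sc V q"
    and y: "y \<in> V"
  defines "u \<equiv> \<lambda>x. INF t\<in>{0..}. q (x + sc t y) - t * q y"
  shows "sublinear_on sc V u"
    and "\<And>x t. x \<in> V \<Longrightarrow> 0 \<le> t \<Longrightarrow> u x \<le> q (x + sc t y) - t * q y"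
proof -
  interpret vector_space sc by fact
  have V: "x + sc t y \<in> V" if "x \<in> V" for x t
    using that y vs(2) by (intro subspace_add subspace_scale)
  have qty: "q (sc t y) = t * q y" if "0 \<le> t" for t
    using that sublinear_on_scale[OF vs q _ y, of t] sublinear_on_zero[OF vs q] by (cases "t = 0") auto
  \<comment> \<open>Subadditivity applied to \<open>sc t y = (x + sc t y) + (- x)\<close> gives a
    lower bound that does not depend on \<open>t\<close>.\<close>
  have bdd: "bdd_below ((\<lambda>t. q (x + sc t y) - t * q y) ` {0..})" if x: "x \<in> V" for x
  proof (rule bdd_belowI2)
    fix t :: real assume "t \<in> {0..}"
    have "q (x + sc t y + - x) \<le> q (x + sc t y) + q (- x)"
      using q V[OF x] subspace_neg[OF vs(2) x] unfolding sublinear_on_def by blast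
    then show "- q (- x) \<le> q (x + sc t y) - t * q y"
      using qty[of t] \<open>t \<in> {0..}\<close> by simp
  qed
  show u_le: "u x \<le> q (x + sc t y) - t * q y" if "x \<in> V" "0 \<le> t" for x t
    unfolding u_def using that by (intro cINF_lower bdd) auto
  have ex: "\<exists>t\<ge>0. q (x + sc t y) - t * q y < u x + e" if "x \<in> V" "0 < e" for x e
  proof -
    have "(INF t\<in>{0..}. q (x + sc t y) - t * q y) < u x + e" using that by (simp add: u_def)
    from iffD1[OF cINF_less_iff[OF _ bdd] this] that show ?thesis by auto
  qed
  show "sublinear_on sc V u"
    unfolding sublinear_on_def
  proof safe
    fix x z assume xz: "x \<in> V" "z \<in> V"
    show "u (x + z) \<le> u x + u z"
    proof (rule field_le_epsilon)
      fix e :: real assume "0 < e"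
      obtain s where s: "0 \<le> s" "q (x + sc s y) - s * q y < u x + e / 2"
        using ex[OF xz(1), of "e / 2"] \<open>0 < e\<close> by auto
      obtain t where t: "0 \<le> t" "q (z + sc t y) - t * q y < u z + e / 2"
        using ex[OF xz(2), of "e / 2"] \<open>0 < e\<close> by auto
      have "u (x + z) \<le> q (x + z + sc (s + t) y) - (s + t) * q y"
        using s(1) t(1) xz by (intro u_le subspace_add[OF vs(2)]) auto
      also have "x + z + sc (s + t) y = (x + sc s y) + (z + sc t y)"
        by (simp add: scale_left_distrib algebra_simps)
      also have "q \<dots> \<le> q (x + sc s y) + q (z + sc t y)"
        using q V xz unfolding sublinear_on_def by blast
      finally show "u (x + z) \<le> u x + u z + e" using s(2) t(2) by (simp add: algebra_simps)
    qed
  next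
    fix c x assume c: "(0::real) < c" and x: "x \<in> V"
    show "u (sc c x) \<le> c * u x"
    proof (rule field_le_epsilon)
      fix e :: real assume "0 < e"
      obtain t where t: "0 \<le> t" "q (x + sc t y) - t * q y < u x + e / c"
        using ex[OF x, of "e / c"] \<open>0 < e\<close> c by auto
      have "u (sc c x) \<le> q (sc c x + sc (c * t) y) - c * t * q y"
        using c t(1) x by (intro u_le subspace_scale[OF vs(2)]) auto
      also have "sc c x + sc (c * t) y = sc c (x + sc t y)"
        by (simp add: scale_right_distrib)
      also have "q \<dots> = c * q (x + sc t y)"
        using sublinear_on_scale[OF vs q c V[OF x]] by simp
      also have "c * q (x + sc t y) - c * t * q y = c * (q (x + sc t y) - t * q y)"
        by (simp add: algebra_simps)
      also have "\<dots> \<le> c * (u x + e / c)" using t(2) c by simp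
      also have "\<dots> = c * u x + e" using c by (simp add: field_simps)
      finally show "u (sc c x) \<le> c * u x + e" .
    qed
  qed
qed

text \<open>The common bound \<open>p\<close> keeps the infimum finite:
  \<open>q x >= - q (- x) >= - p (- x)\<close> for every \<open>q\<close> in
  \<open>C\<close>.\<close>

lemma sublinear_on_INF_chain:
  assumes vs: "vector_space sc" "module.subspace sc V"
    and "C \<noteq> {}" and sub: "\<And>q. q \<in> C \<Longrightarrow> sublinear_on sc V q"
    and chain: "\<And>q r. q \<in> C \<Longrightarrow> r \<in> C \<Longrightarrow> q \<le> r \<or> r \<le> q"
    and dom: "\<And>q. q \<in> C \<Longrightarrow> \<forall>x\<in>V. q x \<le> p x"
  shows "sublinear_on sc V (\<lambda>x. INF q\<in>C. q x)"
    and "\<And>q x. q \<in> C \<Longrightarrow> x \<in> V \<Longrightarrow> (INF q\<in>C. q x) \<le> q x"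
proof -
  interpret vector_space sc by fact
  have bdd: "bdd_below ((\<lambda>q. q x) ` C)" if x: "x \<in> V" for x
  proof (rule bdd_belowI2)
    fix q assume q: "q \<in> C"
    show "- p (- x) \<le> q x"
      using sublinear_on_lower[OF vs sub[OF q] x] bspec[OF dom[OF q] subspace_neg[OF vs(2) x]] by linarith
  qed
  show INF_le: "(INF q\<in>C. q x) \<le> q x" if "q \<in> C" "x \<in> V" for q x
    using that by (intro cINF_lower bdd)
  have ex: "\<exists>q\<in>C. q x < (INF q\<in>C. q x) + e" if "x \<in> V" "0 < e" for x and e :: real
    using cINF_less_iff[OF \<open>C \<noteq> {}\<close> bdd[OF that(1)], of "(INF q\<in>C. q x) + e"] that by simp
  show "sublinear_on sc V (\<lambda>x. INF q\<in>C. q x)"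
    unfolding sublinear_on_def
  proof safe
    fix x y assume xy: "x \<in> V" "y \<in> V"
    show "(INF q\<in>C. q (x + y)) \<le> (INF q\<in>C. q x) + (INF q\<in>C. q y)"
    proof (rule field_le_epsilon)
      fix e :: real assume "0 < e"
      obtain q where q: "q \<in> C" "q x < (INF q\<in>C. q x) + e / 2"
        using ex[OF xy(1), of "e / 2"] \<open>0 < e\<close> by auto
      obtain r where r: "r \<in> C" "r y < (INF q\<in>C. q y) + e / 2"
        using ex[OF xy(2), of "e / 2"] \<open>0 < e\<close> by auto
      \<comment> \<open>Near-minimizers at \<open>x\<close> and at \<open>y\<close> may be different
        members of \<open>C\<close>; comparability yields one member that serves both
        points.\<close>
      obtain s where s: "s \<in> C" "s \<le> q" "s \<le> r"
        using chain[OF q(1) r(1)] q(1) r(1) by blast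
      have "(INF q\<in>C. q (x + y)) \<le> s (x + y)"
        using s(1) xy by (intro INF_le subspace_add[OF vs(2)])
      also have "\<dots> \<le> s x + s y" using sub[OF s(1)] xy by (simp add: sublinear_on_def)
      also have "\<dots> \<le> q x + r y" using s(2,3) by (intro add_mono) (auto simp: le_fun_def)
      finally show "(INF q\<in>C. q (x + y)) \<le> (INF q\<in>C. q x) + (INF q\<in>C. q y) + e"
        using q(2) r(2) by simp
    qed
  next
    fix c x assume c: "(0::real) < c" and x: "x \<in> V"
    have "(INF q\<in>C. q (sc c x)) / c \<le> (INF q\<in>C. q x)"
    proof (rule cINF_greatest[OF \<open>C \<noteq> {}\<close>])
      fix q assume q: "q \<in> C"
      have "(INF q\<in>C. q (sc c x)) \<le> q (sc c x)"
        using q x by (intro INF_le subspace_scale[OF vs(2)])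
      also have "\<dots> \<le> c * q x" using sub[OF q] c x by (simp add: sublinear_on_def)
      finally show "(INF q\<in>C. q (sc c x)) / c \<le> q x" using c by (simp add: field_simps)
    qed
    then show "(INF q\<in>C. q (sc c x)) \<le> c * (INF q\<in>C. q x)" using c by (simp add: field_simps)
  qed
qed

lemma sublinear_on_cong:
  assumes "vector_space sc" "module.subspace sc V" "\<And>x. x \<in> V \<Longrightarrow> q x = r x"
  shows "sublinear_on sc V q \<longleftrightarrow> sublinear_on sc V r"
proof -
  interpret vector_space sc by fact
  show ?thesis
    using assms(3) subspace_add[OF assms(2)] subspace_scale[OF assms(2)]
    unfolding sublinear_on_def by simp
qed

text \<open>
  By Zorn there is a minimal sublinear function below \<open>p\<close>; it equals its own directional infima, which
  makes it superadditive.
\<close>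

theorem dominated_functional_exists:
  assumes vs: "vector_space sc" "module.subspace sc V" and p: "sublinear_on sc V p"
  obtains f where "functional_on sc V f" "\<And>x. x \<in> V \<Longrightarrow> f x \<le> p x"
proof -
  interpret vector_space sc by fact
  \<comment> \<open>The order on functions compares values everywhere, whereas \<open>p\<close> and
    sublinearity control \<open>V\<close> only. The fixed value 0 off \<open>V\<close> turns
    comparison within \<open>A\<close> into comparison on \<open>V\<close>.\<close>
  define A where "A = {q. sublinear_on sc V q \<and> (\<forall>x\<in>V. q x \<le> p x) \<and> (\<forall>x. x \<notin> V \<longrightarrow> q x = 0)}"
  define restr where "restr = (\<lambda>(q :: 'a \<Rightarrow> real) x. if x \<in> V then q x else 0)"
  have restr: "restr q \<in> A" if "sublinear_on sc V q" "\<And>x. x \<in> V \<Longrightarrow> q x \<le> p x" for q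
    using that sublinear_on_cong[OF vs, of "restr q" q] by (simp add: A_def restr_def)
  \<comment> \<open>Zorn's lemma for the reversed order, so that a maximal element is a pointwise
    minimal function; the empty chain is bounded by \<open>p\<close> itself.\<close>
  have "\<exists>m\<in>A. \<forall>q\<in>A. m \<ge> q \<longrightarrow> q = m"
  proof (rule predicate_Zorn)
    show "partial_order_on A (relation_of (\<lambda>q r. q \<ge> r) A)"
      by (rule partial_order_on_relation_ofI) auto
    fix C assume C: "C \<in> Chains (relation_of (\<lambda>q r. q \<ge> r) A)"
    then have CA: "C \<subseteq> A" by (auto simp: Chains_def relation_of_def)
    show "\<exists>u\<in>A. \<forall>q\<in>C. q \<ge> u"
    proof (cases "C = {}")
      case True
      then show ?thesis using restr[OF p] by auto
    next
      case False
      have chain: "q \<le> r \<or> r \<le> q" if "q \<in> C" "r \<in> C" for q r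
        using C that by (auto simp: Chains_def relation_of_def)
      let ?u = "\<lambda>x. INF q\<in>C. q x"
      have sub: "sublinear_on sc V q" "\<forall>x\<in>V. q x \<le> p x" if "q \<in> C" for q
        using CA that by (auto simp: A_def)
      note u = sublinear_on_INF_chain[where p = p, OF vs False sub(1) chain sub(2)]
      have "restr ?u \<in> A"
      proof (rule restr)
        fix x assume "x \<in> V"
        from False obtain q where "q \<in> C" by blast
        with u(2)[of q x] bspec[OF sub(2)[of q] \<open>x \<in> V\<close>] \<open>x \<in> V\<close> show "?u x \<le> p x" by linarith
      qed (use u(1) in blast)
      moreover have "restr ?u \<le> q" if "q \<in> C" for q
        using u(2)[of q] CA that by (auto simp: restr_def le_fun_def A_def)
      ultimately show ?thesis by blast
    qed
  qed
  then obtain m where m: "m \<in> A" and min: "\<And>q. q \<in> A \<Longrightarrow> q \<le> m \<Longrightarrow> q = m" by blast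
  from m have sub_m: "sublinear_on sc V m" and m_le: "\<And>x. x \<in> V \<Longrightarrow> m x \<le> p x"
    and m_0: "\<And>x. x \<notin> V \<Longrightarrow> m x = 0"
    by (auto simp: A_def)
  have "m x + m y \<le> m (x + y)" if xy: "x \<in> V" "y \<in> V" for x y
  proof -
    let ?u = "\<lambda>x. INF t\<in>{0..}. m (x + sc t y) - t * m y"
    note u = sublinear_on_INF_directional[OF vs sub_m xy(2)]
    have u_le: "?u z \<le> m z" if "z \<in> V" for z using u(2)[OF that, of 0] by simp
    then have "restr ?u \<in> A"
      using u(1) m_le by (intro restr) (auto intro: order_trans)
    moreover have "restr ?u \<le> m" using u_le m_0 by (simp add: restr_def le_fun_def)
    ultimately have "restr ?u = m" by (rule min)
    from fun_cong[OF this, of x] have "?u x = m x" using xy(1) by (simp add: restr_def)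
    then show ?thesis using u(2)[OF xy(1), of 1] by simp
  qed
  from functional_on_if_superadditive[OF vs sub_m this] m_le show ?thesis by (rule that)
qed

text \<open>Being an order unit makes the sets \<open>?D x\<close> nonempty, and
  \<open>0 \<notin> K\<close> bounds them below, so the gauge \<open>p\<close> is finite. Bounding
  \<open>p\<close> at both \<open>e\<close> and \<open>- e\<close> fixes \<open>f e\<close> at
  exactly 1, which excludes the zero functional.\<close>

theorem positive_functional_exists:
  assumes vs: "vector_space sc" "module.subspace sc V"
    and KV: "K \<subseteq> V" and K0: "0 \<notin> K"
    and K_add: "\<And>x y. x \<in> K \<Longrightarrow> y \<in> K \<Longrightarrow> x + y \<in> K"
    and K_scale: "\<And>c x. 0 < c \<Longrightarrow> x \<in> K \<Longrightarrow> sc c x \<in> K"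
    and unit: "e \<in> K" "\<And>x. x \<in> V \<Longrightarrow> \<exists>t. sc t e - x \<in> K"
  shows "\<exists>f. functional_on sc V f \<and> f e = 1 \<and> (\<forall>x\<in>K. 0 \<le> f x)"
proof -
  interpret vector_space sc by fact
  let ?D = "\<lambda>x. {t. sc t e - x \<in> K}"
  define p where "p x = Inf (?D x)" for x
  have pos: "0 < t" if "sc t e \<in> K" for t
  proof (rule ccontr)
    assume "\<not> 0 < t"
    then have "sc t e + sc (- t) e \<in> K"
      using that K_add[OF that K_scale[of "- t" e]] unit(1) by (cases "t = 0") (simp_all del: scale_minus_left)
    then show False using K0 by simp
  qed
  have D_ne: "?D x \<noteq> {}" if "x \<in> V" for x using unit(2)[OF that] by blast
  have bdd: "bdd_below (?D x)" if x: "x \<in> V" for x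
  proof -
    \<comment> \<open>If \<open>sc t e - x\<close> and \<open>sc s e + x\<close> are both in
      \<open>K\<close>, so is their sum \<open>sc (t + s) e\<close>, which forces
      \<open>t > - s\<close>.\<close>
    from unit(2)[OF subspace_neg[OF vs(2) x]] obtain s where s: "sc s e - - x \<in> K" by blast
    have "- s \<le> t" if "sc t e - x \<in> K" for t
    proof -
      have "sc t e - x + (sc s e - - x) = sc (t + s) e"
        by (simp add: scale_left_distrib)
      with K_add[OF that s] pos show ?thesis by fastforce
    qed
    then show ?thesis by (intro bdd_belowI[of _ "- s"]) auto
  qed
  have p_le: "p x \<le> t" if "sc t e - x \<in> K" "x \<in> V" for t x
    unfolding p_def using that bdd by (intro cInf_lower) auto
  have ex: "\<exists>t. sc t e - x \<in> K \<and> t < p x + d" if "x \<in> V" "0 < d" for x d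
    using cInf_lessD[OF D_ne[OF that(1)], of "p x + d"] that by (auto simp: p_def)
  have eV: "e \<in> V" using unit(1) KV by blast
  have "sublinear_on sc V p"
    unfolding sublinear_on_def
  proof safe
    fix x y assume xy: "x \<in> V" "y \<in> V"
    show "p (x + y) \<le> p x + p y"
    proof (rule field_le_epsilon)
      fix d :: real assume "0 < d"
      obtain s where s: "sc s e - x \<in> K" "s < p x + d / 2"
        using ex[OF xy(1), of "d / 2"] \<open>0 < d\<close> by auto
      obtain t where t: "sc t e - y \<in> K" "t < p y + d / 2"
        using ex[OF xy(2), of "d / 2"] \<open>0 < d\<close> by auto
      have "sc (s + t) e - (x + y) = sc s e - x + (sc t e - y)"
        by (simp add: scale_left_distrib)
      with K_add[OF s(1) t(1)] have "sc (s + t) e - (x + y) \<in> K" by (simp only:)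
      then have "p (x + y) \<le> s + t" by (rule p_le) (intro subspace_add[OF vs(2)] xy)
      then show "p (x + y) \<le> p x + p y + d" using s(2) t(2) by simp
    qed
  next
    fix c x assume c: "(0::real) < c" and x: "x \<in> V"
    have "p (sc c x) / c \<le> p x"
    proof (rule field_le_epsilon)
      fix d :: real assume "0 < d"
      obtain t where t: "sc t e - x \<in> K" "t < p x + d"
        using ex[OF x \<open>0 < d\<close>] by auto
      have "sc (c * t) e - sc c x = sc c (sc t e - x)"
        by (simp add: scale_right_diff_distrib)
      with K_scale[OF c t(1)] have "sc (c * t) e - sc c x \<in> K" by (simp only:)
      then have "p (sc c x) \<le> c * t" by (rule p_le) (intro subspace_scale[OF vs(2)] x)
      then have "p (sc c x) / c \<le> t" using c by (simp add: field_simps)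
      then show "p (sc c x) / c \<le> p x + d" using t(2) by linarith
    qed
    then show "p (sc c x) \<le> c * p x" using c by (simp add: field_simps)
  qed
  from dominated_functional_exists[OF vs this] obtain f
    where f: "functional_on sc V f" "\<And>x. x \<in> V \<Longrightarrow> f x \<le> p x" by blast
  have f_neg: "f (- x) = - f x" if "x \<in> V" for x
    using f(1) that scale_minus_left[of 1 x] unfolding functional_on_def by (metis mult_minus1 scale_one)
  have p_neg: "p (- x) \<le> 0" if "x \<in> K" for x
  proof (rule field_le_epsilon)
    fix d :: real assume "0 < d"
    then show "p (- x) \<le> 0 + d"
      using K_add[OF K_scale[OF _ unit(1)] that, of d] that KV
      by (intro p_le subspace_neg[OF vs(2)]) auto
  qed
  have f_K: "0 \<le> f x" if "x \<in> K" for x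
    using f(2)[of "- x"] p_neg[OF that] f_neg[of x] that KV subspace_neg[OF vs(2), of x] by force
  \<comment> \<open>The infimum is not attained: \<open>t = 1\<close> would give the vector 0, which
    is outside \<open>K\<close>. The slack \<open>d\<close> here and in the bound at
    \<open>- e\<close> makes up for this.\<close>
  have "p e \<le> 1"
  proof (rule field_le_epsilon)
    fix d :: real assume "0 < d"
    then have "sc d e \<in> K" by (intro K_scale unit(1))
    then show "p e \<le> 1 + d" using eV by (intro p_le) (simp_all add: scale_left_distrib)
  qed
  moreover have "p (- e) \<le> - 1"
  proof (rule field_le_epsilon)
    fix d :: real assume "0 < d"
    then have "sc d e \<in> K" by (intro K_scale unit(1))
    moreover have "sc (- 1 + d) e - - e = sc d e"
      by (simp only: scale_left_distrib scale_minus_left scale_one) simp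
    ultimately have "sc (- 1 + d) e - - e \<in> K" by (simp only:)
    then show "p (- e) \<le> - 1 + d" by (rule p_le) (intro subspace_neg[OF vs(2)] eV)
  qed
  ultimately have "f e = 1"
    using f(2)[OF eV] f(2)[OF subspace_neg[OF vs(2) eV]] f_neg[OF eV] by linarith
  with f(1) f_K show ?thesis by blast
qed

section \<open>Integration against finitely additive probabilities\<close>

lemma bounded_measurable_abs_le:
  assumes "X \<in> bounded_measurable F"
  obtains c where "0 \<le> c" "\<And>\<omega>. \<bar>X \<omega>\<bar> \<le> c"
proof -
  obtain c where c: "\<And>\<omega>. \<omega> \<in> space F \<Longrightarrow> \<bar>X \<omega>\<bar> \<le> c"
    using assms by (auto simp: bounded_measurable_def bounded_iff)
  have "\<bar>X \<omega>\<bar> \<le> \<bar>c\<bar>" for \<omega>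
    using c[of \<omega>] assms by (cases "\<omega> \<in> space F") (auto simp: bounded_measurable_def)
  then show ?thesis by (intro that[of "\<bar>c\<bar>"]) auto
qed

lemma bounded_measurableI:
  assumes "X \<in> borel_measurable F" "\<And>\<omega>. \<omega> \<in> space F \<Longrightarrow> \<bar>X \<omega>\<bar> \<le> c" "\<And>\<omega>. \<omega> \<notin> space F \<Longrightarrow> X \<omega> = 0"
  shows "X \<in> bounded_measurable F"
  using assms by (auto simp: bounded_measurable_def bounded_iff)

lemma bounded_measurable_linear:
  assumes X: "X \<in> bounded_measurable F" and Y: "Y \<in> bounded_measurable F"
  shows "(\<lambda>\<omega>. a * X \<omega> + b * Y \<omega>) \<in> bounded_measurable F"
proof -
  obtain c d where c: "\<And>\<omega>. \<bar>X \<omega>\<bar> \<le> c" and d: "\<And>\<omega>. \<bar>Y \<omega>\<bar> \<le> d"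
    using bounded_measurable_abs_le[OF X] bounded_measurable_abs_le[OF Y] by metis
  show ?thesis
  proof (rule bounded_measurableI)
    show "(\<lambda>\<omega>. a * X \<omega> + b * Y \<omega>) \<in> borel_measurable F"
      using X Y by (auto simp: bounded_measurable_def)
    show "\<bar>a * X \<omega> + b * Y \<omega>\<bar> \<le> \<bar>a\<bar> * c + \<bar>b\<bar> * d" for \<omega>
      using c[of \<omega>] d[of \<omega>]
      by (intro order_trans[OF abs_triangle_ineq] add_mono) (auto simp: abs_mult mult_left_mono)
  qed (use X Y in \<open>auto simp: bounded_measurable_def\<close>)
qed

lemma bounded_measurable_zero: "(\<lambda>_. 0) \<in> bounded_measurable F"
  by (rule bounded_measurableI[of _ _ 0]) auto

lemma bounded_measurable_indicator: "A \<in> sets F \<Longrightarrow> indicator A \<in> bounded_measurable F"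
  by (rule bounded_measurableI[of _ _ 1])
    (auto simp: indicator_def dest: sets.sets_into_space)

lemma simple_function_linear:
  fixes g h :: "'w \<Rightarrow> real"
  assumes "simple_function F g" "simple_function F h"
  shows "simple_function F (\<lambda>\<omega>. a * g \<omega> + b * h \<omega>)"
  using simple_function_compose2[OF assms, of "\<lambda>x y. a * x + b * y"] .

text \<open>Rounding down to multiples of \<open>e\<close> costs at most \<open>e\<close>, and
  boundedness leaves finitely many multiples.\<close>

lemma simple_function_below_bounded_measurable:
  assumes X: "X \<in> bounded_measurable F" and "0 < e"
  shows "\<exists>g. simple_function F g \<and> (\<forall>\<omega>. g \<omega> \<le> X \<omega> \<and> X \<omega> \<le> g \<omega> + e)"
proof (intro exI conjI allI)
  let ?g = "\<lambda>\<omega>. e * \<lfloor>X \<omega> / e\<rfloor>"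
  obtain c where c: "\<And>\<omega>. \<bar>X \<omega>\<bar> \<le> c" using bounded_measurable_abs_le[OF X] by metis
  have "\<lfloor>X \<omega> / e\<rfloor> \<in> {\<lfloor>- c / e\<rfloor>..\<lfloor>c / e\<rfloor>}" for \<omega>
    using divide_right_mono[of "- c" "X \<omega>" e] divide_right_mono[of "X \<omega>" c e] c[of \<omega>] \<open>0 < e\<close>
    by (auto simp: abs_le_iff intro!: floor_mono)
  then have "?g ` space F \<subseteq> (\<lambda>k. e * of_int k) ` {\<lfloor>- c / e\<rfloor>..\<lfloor>c / e\<rfloor>}" by blast
  then have fin: "finite (?g ` space F)" by (rule finite_subset) simp
  have "X \<in> borel_measurable F" using X by (simp add: bounded_measurable_def)
  then have "?g \<in> borel_measurable F" by simp
  with fin show "simple_function F ?g" by (auto simp: simple_function_borel_measurable)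
  show "?g \<omega> \<le> X \<omega>" for \<omega>
    using mult_left_mono[OF of_int_floor_le[of "X \<omega> / e"], of e] \<open>0 < e\<close> by simp
  show "X \<omega> \<le> ?g \<omega> + e" for \<omega>
    using mult_left_mono[OF real_of_int_floor_add_one_ge[of "X \<omega> / e"], of e] \<open>0 < e\<close>
    by (simp add: distrib_left)
qed

section \<open>Elementary properties of finitely additive probabilities\<close>

lemma fa_prob_empty:
  assumes "fa_prob F \<phi>"
  shows "\<phi> {} = 0"
proof -
  have "\<phi> ({} \<union> {}) = \<phi> {} + \<phi> {}"
    using assms by (intro additiveD[of "sets F"]) (auto simp: fa_prob_def)
  then show ?thesis by simp
qed

lemma fa_prob_UN:
  assumes "fa_prob F \<phi>" "finite I" "\<And>i. i \<in> I \<Longrightarrow> A i \<in> sets F" "disjoint_family_on A I"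
  shows "\<phi> (\<Union>i\<in>I. A i) = (\<Sum>i\<in>I. \<phi> (A i))"
  using assms(2-4)
proof (induction I rule: finite_induct)
  case empty
  then show ?case using fa_prob_empty[OF assms(1)] by simp
next
  case (insert i I)
  then have "A i \<inter> (\<Union>i\<in>I. A i) = {}" by (auto simp: disjoint_family_on_def)
  with insert assms(1) have "\<phi> (A i \<union> (\<Union>i\<in>I. A i)) = \<phi> (A i) + \<phi> (\<Union>i\<in>I. A i)"
    by (intro additiveD[of "sets F"] sets.finite_UN) (auto simp: fa_prob_def)
  with insert show ?case by (simp add: disjoint_family_on_def)
qed

lemma fa_prob_mono:
  assumes "fa_prob F \<phi>" "A \<in> sets F" "B \<in> sets F" "A \<subseteq> B"
  shows "\<phi> A \<le> \<phi> B"
proof -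
  have "\<phi> (A \<union> (B - A)) = \<phi> A + \<phi> (B - A)"
    using assms by (intro additiveD[of "sets F"]) (auto simp: fa_prob_def)
  moreover have "A \<union> (B - A) = B" using assms by auto
  moreover have "0 \<le> \<phi> (B - A)" using assms by (auto simp: fa_prob_def)
  ultimately show ?thesis by simp
qed

lemma fa_prob_subset_null:
  assumes "fa_prob F \<phi>" "A \<in> sets F" "N \<in> sets F" "A \<subseteq> N" "\<phi> N = 0"
  shows "\<phi> A = 0"
  using fa_prob_mono[OF assms(1-4)] assms by (auto simp: fa_prob_def intro: antisym)

section \<open>Integrals of simple functions\<close>

lemma simple_fa_integral_compose:
  assumes \<phi>: "fa_prob F \<phi>" and k: "simple_function F k"
  shows "simple_fa_integral F \<phi> (\<lambda>\<omega>. f (k \<omega>)) =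
    (\<Sum>z\<in>k ` space F. f z * \<phi> (k -` {z} \<inter> space F))"
proof -
  have fin: "finite (k ` space F)" and meas: "\<And>z. z \<in> k ` space F \<Longrightarrow> k -` {z} \<inter> space F \<in> sets F"
    using k by (auto simp: simple_function_def)
  \<comment> \<open>A level set of the composition is a finite disjoint union of level sets of
    \<open>k\<close>, so finite additivity suffices.\<close>
  have fibre: "\<phi> ((\<lambda>\<omega>. f (k \<omega>)) -` {y} \<inter> space F) =
      (\<Sum>z\<in>{z. z \<in> k ` space F \<and> f z = y}. \<phi> (k -` {z} \<inter> space F))" for y
  proof -
    have "(\<lambda>\<omega>. f (k \<omega>)) -` {y} \<inter> space F =
        (\<Union>z\<in>{z. z \<in> k ` space F \<and> f z = y}. k -` {z} \<inter> space F)"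
      by auto
    then show ?thesis
      using fin meas by (simp only:, intro fa_prob_UN[OF \<phi>]) (auto simp: disjoint_family_on_def)
  qed
  have "(\<Sum>z\<in>k ` space F. f z * \<phi> (k -` {z} \<inter> space F)) =
      (\<Sum>y\<in>f ` (k ` space F). \<Sum>z\<in>{z. z \<in> k ` space F \<and> f z = y}. f z * \<phi> (k -` {z} \<inter> space F))"
    by (rule sum.image_gen[OF fin])
  also have "\<dots> = (\<Sum>y\<in>f ` (k ` space F). y * \<phi> ((\<lambda>\<omega>. f (k \<omega>)) -` {y} \<inter> space F))"
    by (intro sum.cong) (auto simp: fibre sum_distrib_left intro!: sum.cong)
  finally show ?thesis by (simp add: simple_fa_integral_def image_image)
qed

text \<open>The pair of \<open>g\<close> and \<open>h\<close> is itself simple. Writing all three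
  integrals as sums over its level sets puts them on a common partition, where linearity is
  linearity of finite sums.\<close>

lemma simple_fa_integral_linear:
  assumes \<phi>: "fa_prob F \<phi>" and g: "simple_function F g" and h: "simple_function F h"
  shows "simple_fa_integral F \<phi> (\<lambda>\<omega>. a * g \<omega> + b * h \<omega>) =
    a * simple_fa_integral F \<phi> g + b * simple_fa_integral F \<phi> h"
  using simple_fa_integral_compose[OF \<phi> simple_function_Pair[OF g h], of "\<lambda>z. a * fst z + b * snd z"]
    simple_fa_integral_compose[OF \<phi> simple_function_Pair[OF g h], of fst]
    simple_fa_integral_compose[OF \<phi> simple_function_Pair[OF g h], of snd]
  by (simp add: sum.distrib sum_distrib_left algebra_simps)

text \<open>On the common partition given by the pair, a cell where \<open>g\<close> exceeds
  \<open>h\<close> lies inside \<open>N\<close> and so has mass 0; on all other cells the summands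
  are ordered.\<close>

lemma simple_fa_integral_mono_null:
  assumes \<phi>: "fa_prob F \<phi>" and g: "simple_function F g" and h: "simple_function F h"
    and N: "N \<in> sets F" "\<phi> N = 0" and le: "\<And>\<omega>. \<omega> \<in> space F - N \<Longrightarrow> g \<omega> \<le> h \<omega>"
  shows "simple_fa_integral F \<phi> g \<le> simple_fa_integral F \<phi> h"
proof -
  let ?k = "\<lambda>\<omega>. (g \<omega>, h \<omega>)"
  note k = simple_function_Pair[OF g h]
  have "fst z * \<phi> (?k -` {z} \<inter> space F) \<le> snd z * \<phi> (?k -` {z} \<inter> space F)"
    if "z \<in> ?k ` space F" for z
  proof -
    have meas: "?k -` {z} \<inter> space F \<in> sets F" using k that unfolding simple_function_def by blast
    show ?thesis
    proof (cases "fst z \<le> snd z")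
      case True
      then show ?thesis using \<phi> meas by (auto simp: fa_prob_def intro!: mult_right_mono)
    next
      case False
      then have "?k -` {z} \<inter> space F \<subseteq> N" using le by fastforce
      from fa_prob_subset_null[OF \<phi> meas N(1) this N(2)] show ?thesis by simp
    qed
  qed
  then show ?thesis
    using simple_fa_integral_compose[OF \<phi> k, of fst] simple_fa_integral_compose[OF \<phi> k, of snd]
    by (simp add: sum_mono)
qed

lemma simple_fa_integral_const:
  assumes "fa_prob F \<phi>"
  shows "simple_fa_integral F \<phi> (\<lambda>_. c) = c"
proof -
  have "space F \<noteq> {}" using assms fa_prob_empty[OF assms] by (auto simp: fa_prob_def)
  then show ?thesis using assms by (simp add: simple_fa_integral_def image_constant_conv fa_prob_def)
qed

lemma simple_fa_integral_indicator:
  assumes \<phi>: "fa_prob F \<phi>" and A: "A \<in> sets F"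
  shows "simple_fa_integral F \<phi> (\<lambda>\<omega>. c * indicator A \<omega>) = c * \<phi> A"
proof -
  have Collect: "{\<omega> \<in> space F. \<omega> \<in> A} = A" using A sets.sets_into_space by auto
  have k: "simple_function F (\<lambda>\<omega>. \<omega> \<in> A)"
    using A by (auto simp: simple_function_def vimage_def Int_def[symmetric] Collect intro: finite_subset[OF subset_UNIV])
  have "simple_fa_integral F \<phi> (\<lambda>\<omega>. c * indicator A \<omega>) =
      (\<Sum>z\<in>(\<lambda>\<omega>. \<omega> \<in> A) ` space F. (c * of_bool z) * \<phi> ((\<lambda>\<omega>. \<omega> \<in> A) -` {z} \<inter> space F))"
    using simple_fa_integral_compose[OF \<phi> k, of "\<lambda>z. c * of_bool z"] by (simp add: indicator_def of_bool_def)
  \<comment> \<open>Both truth values are summed because one of them is missing from the range if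
    \<open>A\<close> is empty or the whole space; its fibre is then empty and has mass 0.\<close>
  also have "\<dots> = (\<Sum>z\<in>UNIV. (c * of_bool z) * \<phi> ((\<lambda>\<omega>. \<omega> \<in> A) -` {z} \<inter> space F))"
  proof (intro sum.mono_neutral_left ballI)
    fix z assume "z \<in> UNIV - (\<lambda>\<omega>. \<omega> \<in> A) ` space F"
    then have "(\<lambda>\<omega>. \<omega> \<in> A) -` {z} \<inter> space F = {}" by auto
    then show "(c * of_bool z) * \<phi> ((\<lambda>\<omega>. \<omega> \<in> A) -` {z} \<inter> space F) = 0"
      using fa_prob_empty[OF \<phi>] by simp
  qed auto
  also have "\<dots> = c * \<phi> A"
    using A sets.sets_into_space by (simp add: UNIV_bool vimage_def Int_absorb2 Int_commute)
  finally show ?thesis .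
qed

section \<open>Integrals of bounded measurable functions\<close>

lemma simple_fa_integral_le_fa_integral:
  assumes \<phi>: "fa_prob F \<phi>" and X: "X \<in> bounded_measurable F" and g: "simple_function F g"
    and N: "N \<in> sets F" "\<phi> N = 0" and le: "\<And>\<omega>. \<omega> \<in> space F - N \<Longrightarrow> g \<omega> \<le> X \<omega>"
  shows "simple_fa_integral F \<phi> g \<le> fa_integral F \<phi> X"
proof -
  obtain c where c: "\<And>\<omega>. \<bar>X \<omega>\<bar> \<le> c" using bounded_measurable_abs_le[OF X] by metis
  \<comment> \<open>This bound makes the supremum in \<open>fa_integral\<close> a true least upper
    bound.\<close>
  have bound: "simple_fa_integral F \<phi> h \<le> c" if "simple_function F h" "\<forall>\<omega>\<in>space F. h \<omega> \<le> X \<omega>" for h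
  proof -
    have "h \<omega> \<le> c" if "\<omega> \<in> space F - {}" for \<omega>
      using c[of \<omega>] \<open>\<forall>\<omega>\<in>space F. h \<omega> \<le> X \<omega>\<close> that by (force simp: abs_le_iff)
    from simple_fa_integral_mono_null[OF \<phi> that(1) simple_function_const[of F c] sets.empty_sets
        fa_prob_empty[OF \<phi>] this]
    show ?thesis by (simp add: simple_fa_integral_const[OF \<phi>])
  qed
  \<comment> \<open>The supremum is over minorants on the whole space, but \<open>g\<close> may
    exceed \<open>X\<close> on \<open>N\<close>. Overwriting \<open>g\<close> there by
    \<open>- c\<close>, a lower bound of \<open>X\<close>, gives a minorant without lowering the
    integral.\<close>
  let ?g = "\<lambda>\<omega>. if \<omega> \<in> N then - c else g \<omega>"
  have sg: "simple_function F ?g" using g N(1) by (intro simple_function_If_set) auto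
  have "simple_fa_integral F \<phi> g \<le> simple_fa_integral F \<phi> ?g"
    by (rule simple_fa_integral_mono_null[OF \<phi> g sg N]) auto
  also have "\<dots> \<le> fa_integral F \<phi> X"
    unfolding fa_integral_def
  proof (rule cSUP_upper)
    have "- c \<le> X \<omega>" for \<omega> using c[of \<omega>] by (simp add: abs_le_iff)
    then show "?g \<in> {g. simple_function F g \<and> (\<forall>\<omega>\<in>space F. g \<omega> \<le> X \<omega>)}" using sg le by auto
  qed (use bound in \<open>auto intro!: bdd_aboveI2[where M = c]\<close>)
  finally show ?thesis .
qed

lemma fa_integral_least:
  assumes X: "X \<in> bounded_measurable F"
    and "\<And>g. simple_function F g \<Longrightarrow> (\<And>\<omega>. \<omega> \<in> space F \<Longrightarrow> g \<omega> \<le> X \<omega>) \<Longrightarrow> simple_fa_integral F \<phi> g \<le> a"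
  shows "fa_integral F \<phi> X \<le> a"
  unfolding fa_integral_def
proof (rule cSUP_least)
  show "{g. simple_function F g \<and> (\<forall>\<omega>\<in>space F. g \<omega> \<le> X \<omega>)} \<noteq> {}"
    using simple_function_below_bounded_measurable[OF X zero_less_one] by blast
qed (use assms(2) in auto)

lemma fa_integral_mono_null:
  assumes "fa_prob F \<phi>" "X \<in> bounded_measurable F" "Y \<in> bounded_measurable F"
    and "N \<in> sets F" "\<phi> N = 0" "\<And>\<omega>. \<omega> \<in> space F - N \<Longrightarrow> X \<omega> \<le> Y \<omega>"
  shows "fa_integral F \<phi> X \<le> fa_integral F \<phi> Y"
  using assms by (intro fa_integral_least simple_fa_integral_le_fa_integral[where N = N])
    (auto intro: order_trans)

text \<open>The one-sided Lipschitz estimate behind lower semicontinuity of expected-value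
  preferences: lowering a simple minorant of \<open>X\<close> by \<open>e\<close> gives a minorant
  of \<open>Y\<close>.\<close>

lemma fa_integral_le_add:
  assumes \<phi>: "fa_prob F \<phi>" and X: "X \<in> bounded_measurable F" and Y: "Y \<in> bounded_measurable F"
    and le: "\<And>\<omega>. \<omega> \<in> space F \<Longrightarrow> X \<omega> \<le> Y \<omega> + e"
  shows "fa_integral F \<phi> X \<le> fa_integral F \<phi> Y + e"
proof (rule fa_integral_least[OF X])
  fix g assume g: "simple_function F g" "\<And>\<omega>. \<omega> \<in> space F \<Longrightarrow> g \<omega> \<le> X \<omega>"
  let ?h = "\<lambda>\<omega>. 1 * g \<omega> + - e * 1"
  have "simple_fa_integral F \<phi> ?h \<le> fa_integral F \<phi> Y"
    using g le fa_prob_empty[OF \<phi>]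
    by (intro simple_fa_integral_le_fa_integral[where N = "{}"] \<phi> Y simple_function_linear) force+
  also have "simple_fa_integral F \<phi> ?h = simple_fa_integral F \<phi> g - e"
    using simple_fa_integral_linear[OF \<phi> g(1) simple_function_const[of F 1], of 1 "- e"]
      simple_fa_integral_const[OF \<phi>, of 1] by simp
  finally show "simple_fa_integral F \<phi> g \<le> fa_integral F \<phi> Y + e" by simp
qed

lemma fa_integral_zero:
  assumes "fa_prob F \<phi>"
  shows "fa_integral F \<phi> (\<lambda>_. 0) = 0"
proof (rule antisym)
  note const = simple_function_const[of F "0 :: real"] simple_fa_integral_const[OF assms, of 0]
  show "fa_integral F \<phi> (\<lambda>_. 0) \<le> 0"
    using simple_fa_integral_mono_null[OF assms _ const(1) sets.empty_sets fa_prob_empty[OF assms]] const(2)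
    by (intro fa_integral_least bounded_measurable_zero) auto
  show "0 \<le> fa_integral F \<phi> (\<lambda>_. 0)"
    using simple_fa_integral_le_fa_integral[OF assms bounded_measurable_zero const(1) sets.empty_sets
        fa_prob_empty[OF assms]] const(2)
    by simp
qed

text \<open>A convex combination of minorants is a minorant of the combination, so a supremum over
  minorants is concave. Concavity is what convex upper contour sets ask for.\<close>

lemma fa_integral_concave:
  assumes \<phi>: "fa_prob F \<phi>" and X: "X \<in> bounded_measurable F" and Y: "Y \<in> bounded_measurable F"
    and u: "0 \<le> u" "u \<le> 1"
  shows "(1 - u) * fa_integral F \<phi> X + u * fa_integral F \<phi> Y
    \<le> fa_integral F \<phi> (\<lambda>\<omega>. (1 - u) * X \<omega> + u * Y \<omega>)" (is "_ \<le> ?E")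
proof -
  have approx: "\<exists>g. simple_function F g \<and> (\<forall>\<omega>\<in>space F. g \<omega> \<le> Z \<omega>) \<and>
      fa_integral F \<phi> Z - e < simple_fa_integral F \<phi> g"
    if "Z \<in> bounded_measurable F" "0 < e" for Z e
  proof (rule ccontr)
    assume none: "\<not> ?thesis"
    have "fa_integral F \<phi> Z \<le> fa_integral F \<phi> Z - e"
    proof (rule fa_integral_least[OF that(1)])
      fix g assume "simple_function F g" "\<And>\<omega>. \<omega> \<in> space F \<Longrightarrow> g \<omega> \<le> Z \<omega>"
      then show "simple_fa_integral F \<phi> g \<le> fa_integral F \<phi> Z - e"
        using none by (intro leI notI) blast
    qed
    then show False using \<open>0 < e\<close> by simp
  qed
  show ?thesis
  proof (rule field_le_epsilon)
    fix e :: real assume "0 < e"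
    obtain g where g: "simple_function F g" "\<And>\<omega>. \<omega> \<in> space F \<Longrightarrow> g \<omega> \<le> X \<omega>"
        "fa_integral F \<phi> X - e < simple_fa_integral F \<phi> g"
      using approx[OF X \<open>0 < e\<close>] by auto
    obtain h where h: "simple_function F h" "\<And>\<omega>. \<omega> \<in> space F \<Longrightarrow> h \<omega> \<le> Y \<omega>"
        "fa_integral F \<phi> Y - e < simple_fa_integral F \<phi> h"
      using approx[OF Y \<open>0 < e\<close>] by auto
    have "(1 - u) * (fa_integral F \<phi> X - e) + u * (fa_integral F \<phi> Y - e)
        \<le> (1 - u) * simple_fa_integral F \<phi> g + u * simple_fa_integral F \<phi> h"
      using u g(3) h(3) by (intro add_mono mult_left_mono) auto
    also have "\<dots> = simple_fa_integral F \<phi> (\<lambda>\<omega>. (1 - u) * g \<omega> + u * h \<omega>)"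
      using simple_fa_integral_linear[OF \<phi> g(1) h(1)] by simp
    also have "\<dots> \<le> ?E"
      using u g h fa_prob_empty[OF \<phi>]
      by (intro simple_fa_integral_le_fa_integral[where N = "{}"] \<phi> bounded_measurable_linear X Y
          simple_function_linear add_mono mult_left_mono) auto
    finally show "(1 - u) * fa_integral F \<phi> X + u * fa_integral F \<phi> Y \<le> ?E + e"
      by (simp add: algebra_simps)
  qed
qed

section \<open>Agents and supporting functionals\<close>

abbreviation fun_scale :: "real \<Rightarrow> ('w \<Rightarrow> real) \<Rightarrow> 'w \<Rightarrow> real" where
  "fun_scale \<equiv> \<lambda>c X \<omega>. c * X \<omega>"

lemma vector_space_fun_scale: "vector_space fun_scale"
  by unfold_locales (auto simp: fun_eq_iff algebra_simps)

lemma subspace_fun_scaleI: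
  assumes "0 \<in> V" "\<And>X Y a b. X \<in> V \<Longrightarrow> Y \<in> V \<Longrightarrow> (\<lambda>\<omega>. a * X \<omega> + b * Y \<omega>) \<in> V"
  shows "module.subspace fun_scale V"
proof -
  interpret vector_space fun_scale by (rule vector_space_fun_scale)
  show ?thesis
    using assms(1) assms(2)[of _ _ 1 1] assms(2)[of _ 0 _ 0] by (intro subspaceI) (auto simp: plus_fun_def)
qed

lemma subspace_bounded_measurable: "module.subspace fun_scale (bounded_measurable F)"
  using bounded_measurable_zero by (intro subspace_fun_scaleI bounded_measurable_linear) (auto simp: zero_fun_def)

lemma functional_on_linear:
  assumes "module.subspace fun_scale V" "functional_on fun_scale V f" "X \<in> V" "Y \<in> V"
  shows "f (\<lambda>\<omega>. a * X \<omega> + b * Y \<omega>) = a * f X + b * f Y"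
proof -
  interpret vector_space fun_scale by (rule vector_space_fun_scale)
  have aX: "(\<lambda>\<omega>. a * X \<omega>) \<in> V" and bY: "(\<lambda>\<omega>. b * Y \<omega>) \<in> V"
    using subspace_scale[OF assms(1,3), of a] subspace_scale[OF assms(1,4), of b] by simp_all
  have "f ((\<lambda>\<omega>. a * X \<omega>) + (\<lambda>\<omega>. b * Y \<omega>)) = a * f X + b * f Y"
    using assms(2-4) aX bY unfolding functional_on_def by metis
  then show ?thesis by (simp add: plus_fun_def)
qed

lemma functional_on_sum:
  assumes V: "module.subspace fun_scale V" and f: "functional_on fun_scale V f"
    and "finite I" "\<And>i. i \<in> I \<Longrightarrow> X i \<in> V"
  shows "(\<lambda>\<omega>. \<Sum>i\<in>I. a i * X i \<omega>) \<in> V \<and> f (\<lambda>\<omega>. \<Sum>i\<in>I. a i * X i \<omega>) = (\<Sum>i\<in>I. a i * f (X i))"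
  using assms(3,4)
proof (induction I rule: finite_induct)
  case empty
  interpret vector_space fun_scale by (rule vector_space_fun_scale)
  have "0 \<in> V" by (rule subspace_0[OF V])
  then show ?case using functional_on_linear[OF V f, of 0 0 0 0] by (simp add: zero_fun_def)
next
  case (insert i I)
  interpret vector_space fun_scale by (rule vector_space_fun_scale)
  let ?Y = "\<lambda>\<omega>. \<Sum>i\<in>I. a i * X i \<omega>"
  have Y: "?Y \<in> V" "f ?Y = (\<Sum>i\<in>I. a i * f (X i))" and X: "X i \<in> V" using insert by auto
  have "(\<lambda>\<omega>. a i * X i \<omega>) + ?Y \<in> V"
    using subspace_scale[OF V X, of "a i"] Y(1) by (intro subspace_add[OF V])
  then show ?case
    using functional_on_linear[OF V f X Y(1), of "a i" 1] Y(2) insert.hyps by (simp add: plus_fun_def)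
qed

text \<open>The finitely additive Riesz representation. On simple functions the two sides agree by
  linearity; positivity makes \<open>f\<close> monotone, so uniform approximation from below by
  simple functions extends the equality.\<close>

lemma fa_prob_of_positive_functional:
  assumes f: "functional_on fun_scale (bounded_measurable F) f"
    and pos: "\<And>X. X \<in> bounded_measurable F \<Longrightarrow> \<forall>\<omega>. 0 \<le> X \<omega> \<Longrightarrow> 0 \<le> f X"
    and one: "f (indicator (space F)) = 1"
  shows "fa_prob F (\<lambda>A. f (indicator A))"
    and "X \<in> bounded_measurable F \<Longrightarrow> fa_integral F (\<lambda>A. f (indicator A)) X = f X"
proof -
  let ?\<phi> = "\<lambda>A. f (indicator A)"
  note V = subspace_bounded_measurable[of F]
  note lin = functional_on_linear[OF V f]
  note ind = bounded_measurable_indicator[of _ F]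
  have mono: "f X \<le> f Y"
    if "X \<in> bounded_measurable F" "Y \<in> bounded_measurable F" "\<And>\<omega>. X \<omega> \<le> Y \<omega>" for X Y
    using pos[OF bounded_measurable_linear[OF that(2,1), of 1 "- 1"]] that(3) lin[OF that(2,1), of 1 "- 1"]
    by simp
  show fa: "fa_prob F ?\<phi>"
    unfolding fa_prob_def additive_def
  proof (intro conjI ballI impI)
    fix A B assume AB: "A \<in> sets F" "B \<in> sets F" "A \<inter> B = {}"
    have "indicator (A \<union> B) = (\<lambda>\<omega>. 1 * indicator A \<omega> + 1 * indicator B \<omega> :: real)"
      using AB(3) by (auto simp: fun_eq_iff indicator_def)
    then show "?\<phi> (A \<union> B) = ?\<phi> A + ?\<phi> B" using lin[OF ind[OF AB(1)] ind[OF AB(2)], of 1 1] by simp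
  qed (use pos ind one in auto)
  \<comment> \<open>A simple function may take any values off \<open>space F\<close>, whereas
    members of \<open>bounded_measurable F\<close> vanish there; multiplying by the indicator cuts
    \<open>g\<close> down. For the same reason the constant \<open>e\<close> appears below as
    \<open>e * indicator (space F)\<close>.\<close>
  have simple: "(\<lambda>\<omega>. g \<omega> * indicator (space F) \<omega>) \<in> bounded_measurable F \<and>
      simple_fa_integral F ?\<phi> g = f (\<lambda>\<omega>. g \<omega> * indicator (space F) \<omega>)"
    if g: "simple_function F g" for g
  proof -
    have "(\<lambda>\<omega>. g \<omega> * indicator (space F) \<omega>) =
        (\<lambda>\<omega>. \<Sum>y\<in>g ` space F. y * indicator (g -` {y} \<inter> space F) \<omega>)"
    proof
      fix \<omega>
      have "(\<Sum>y\<in>g ` space F. y * indicator (g -` {y} \<inter> space F) \<omega>) =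
          (\<Sum>y\<in>g ` space F. if y = g \<omega> then g \<omega> * indicator (space F) \<omega> else 0)"
        by (intro sum.cong) (auto simp: indicator_def)
      also have "\<dots> = g \<omega> * indicator (space F) \<omega>"
        using g by (auto simp: sum.delta simple_function_def indicator_def)
      finally show "g \<omega> * indicator (space F) \<omega> =
        (\<Sum>y\<in>g ` space F. y * indicator (g -` {y} \<inter> space F) \<omega>)" by simp
    qed
    then show ?thesis
      using functional_on_sum[OF V f, of "g ` space F" "\<lambda>y. indicator (g -` {y} \<inter> space F)" "\<lambda>y. y"] g ind
      by (simp add: simple_fa_integral_def simple_function_def)
  qed
  show "fa_integral F ?\<phi> X = f X" if X: "X \<in> bounded_measurable F"
  proof (rule antisym)
    have X0: "X \<omega> = 0" if "\<omega> \<notin> space F" for \<omega> using X that by (simp add: bounded_measurable_def)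
    show "fa_integral F ?\<phi> X \<le> f X"
    proof (rule fa_integral_least[OF X])
      fix g assume g: "simple_function F g" "\<And>\<omega>. \<omega> \<in> space F \<Longrightarrow> g \<omega> \<le> X \<omega>"
      have "g \<omega> * indicator (space F) \<omega> \<le> X \<omega>" for \<omega>
        using g(2)[of \<omega>] X0[of \<omega>] by (cases "\<omega> \<in> space F") auto
      then show "simple_fa_integral F ?\<phi> g \<le> f X" using simple[OF g(1)] mono X by auto
    qed
    show "f X \<le> fa_integral F ?\<phi> X"
    proof (rule field_le_epsilon)
      fix e :: real assume "0 < e"
      obtain g where g: "simple_function F g" "\<And>\<omega>. g \<omega> \<le> X \<omega>" "\<And>\<omega>. X \<omega> \<le> g \<omega> + e"
        using simple_function_below_bounded_measurable[OF X \<open>0 < e\<close>] by blast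
      let ?g = "\<lambda>\<omega>. g \<omega> * indicator (space F) \<omega>"
      have gV: "?g \<in> bounded_measurable F" using simple[OF g(1)] by blast
      have le: "X \<omega> \<le> 1 * ?g \<omega> + e * indicator (space F) \<omega>" for \<omega>
        using g(3)[of \<omega>] X0[of \<omega>] by (cases "\<omega> \<in> space F") auto
      have "f X \<le> f (\<lambda>\<omega>. 1 * ?g \<omega> + e * indicator (space F) \<omega>)"
        by (rule mono[OF X bounded_measurable_linear[OF gV ind[OF sets.top]] le])
      also have "\<dots> = 1 * f ?g + e * f (indicator (space F))"
        by (rule lin[OF gV ind[OF sets.top]])
      also have "\<dots> = simple_fa_integral F ?\<phi> g + e" using simple[OF g(1)] one by simp
      also have "simple_fa_integral F ?\<phi> g \<le> fa_integral F ?\<phi> X"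
        using g(2) fa_prob_empty[OF fa]
        by (intro simple_fa_integral_le_fa_integral[OF fa X g(1) sets.empty_sets]) auto
      finally show "f X \<le> fa_integral F ?\<phi> X + e" by simp
    qed
  qed
qed

lemma expectation_preference_agent:
  assumes \<phi>: "fa_prob F \<phi>"
    and le: "\<And>X Y. X \<in> bounded_measurable F \<Longrightarrow> Y \<in> bounded_measurable F \<Longrightarrow> le X Y \<Longrightarrow>
      fa_integral F \<phi> X \<le> fa_integral F \<phi> Y"
  shows "{(X, Y). X \<in> bounded_measurable F \<and> Y \<in> bounded_measurable F \<and>
      fa_integral F \<phi> X \<le> fa_integral F \<phi> Y} \<in> agents (bounded_measurable F) (sup_topology F) le"
    (is "?r \<in> agents ?H _ _")
proof -
  have convex: "convex_funs {Z \<in> ?H. (X, Z) \<in> ?r}" if "X \<in> ?H" for X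
    unfolding convex_funs_def
  proof (intro ballI allI impI)
    fix Y Z u assume YZ: "Y \<in> {Z \<in> ?H. (X, Z) \<in> ?r}" "Z \<in> {Z \<in> ?H. (X, Z) \<in> ?r}" and u: "0 \<le> u \<and> u \<le> (1::real)"
    have "fa_integral F \<phi> X = (1 - u) * fa_integral F \<phi> X + u * fa_integral F \<phi> X"
      by (simp add: algebra_simps)
    also have "\<dots> \<le> (1 - u) * fa_integral F \<phi> Y + u * fa_integral F \<phi> Z"
      using YZ u by (intro add_mono mult_left_mono) auto
    also have "\<dots> \<le> fa_integral F \<phi> (\<lambda>\<omega>. (1 - u) * Y \<omega> + u * Z \<omega>)"
      using YZ u by (intro fa_integral_concave[OF \<phi>]) auto
    finally show "(\<lambda>\<omega>. (1 - u) * Y \<omega> + u * Z \<omega>) \<in> {Z \<in> ?H. (X, Z) \<in> ?r}"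
      using that YZ by (auto intro: bounded_measurable_linear)
  qed
  have closed: "(X, Y) \<in> ?r"
    if Xn: "\<And>n. Xn n \<in> ?H" and XY: "X \<in> ?H" "Y \<in> ?H"
      and lim: "limitin (sup_topology F) Xn X sequentially" and Xn_le: "\<And>n. (Xn n, Y) \<in> ?r" for Xn X Y
  proof -
    have "fa_integral F \<phi> X \<le> fa_integral F \<phi> Y"
    proof (rule field_le_epsilon)
      fix e :: real assume "0 < e"
      have "uniform_limit (space F) Xn X sequentially"
        using lim limitin_sup_topology_iff[where Xn = Xn, OF Xn XY(1)] by blast
      then have "\<forall>\<^sub>F n in sequentially. \<forall>\<omega>\<in>space F. dist (Xn n \<omega>) (X \<omega>) < e"
        using \<open>0 < e\<close> by (rule uniform_limitD)
      then obtain n where n: "\<And>\<omega>. \<omega> \<in> space F \<Longrightarrow> dist (Xn n \<omega>) (X \<omega>) < e"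
        by (auto simp: eventually_sequentially)
      have "fa_integral F \<phi> X \<le> fa_integral F \<phi> (Xn n) + e"
      proof (rule fa_integral_le_add[OF \<phi> XY(1) Xn])
        fix \<omega> assume "\<omega> \<in> space F"
        from n[OF this] show "X \<omega> \<le> Xn n \<omega> + e" by (simp add: dist_real_def)
      qed
      also have "fa_integral F \<phi> (Xn n) \<le> fa_integral F \<phi> Y" using Xn_le[of n] by simp
      finally show "fa_integral F \<phi> X \<le> fa_integral F \<phi> Y + e" by simp
    qed
    with XY show ?thesis by simp
  qed
  show ?thesis
    unfolding agents_def
  proof (intro CollectI conjI)
    show "trans ?r" by (auto simp: trans_def)
    show "\<forall>X\<in>?H. convex_funs {Z \<in> ?H. (X, Z) \<in> ?r}" using convex by blast
    show "\<forall>Xn X Y. (\<forall>n. Xn n \<in> ?H) \<and> X \<in> ?H \<and> Y \<in> ?H \<and>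
        limitin (sup_topology F) Xn X sequentially \<and> (\<forall>n. (Xn n, Y) \<in> ?r) \<longrightarrow> (X, Y) \<in> ?r"
    proof (intro allI impI)
      fix Xn X Y
      assume lim: "(\<forall>n. Xn n \<in> ?H) \<and> X \<in> ?H \<and> Y \<in> ?H \<and>
        limitin (sup_topology F) Xn X sequentially \<and> (\<forall>n. (Xn n, Y) \<in> ?r)"
      show "(X, Y) \<in> ?r" by (rule closed[of Xn X Y]) (use lim in auto)
    qed
  qed (use le in auto)
qed

section \<open>From an agent to a supporting functional\<close>

lemma agents_lower_semicontinuousD:
  assumes r: "r \<in> agents H \<tau> le"
    and lim: "\<And>n. Xn n \<in> H" "X \<in> H" "Y \<in> H" "limitin \<tau> Xn X sequentially" "\<And>n. (Xn n, Y) \<in> r"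
  shows "(X, Y) \<in> r"
proof -
  have "\<forall>Xn X Y. (\<forall>n. Xn n \<in> H) \<and> X \<in> H \<and> Y \<in> H \<and> limitin \<tau> Xn X sequentially \<and>
      (\<forall>n. (Xn n, Y) \<in> r) \<longrightarrow> (X, Y) \<in> r"
    using r unfolding agents_def mem_Collect_eq by (elim conjE)
  from spec[OF spec[OF spec[OF this, of Xn], of X], of Y] lim show ?thesis by simp
qed

text \<open>The less preferred of \<open>Y\<close> and \<open>Z\<close>, called \<open>V\<close>,
  has both in its weak upper contour set, hence also the combination. If the combination were weakly
  below \<open>W\<close>, transitivity would put \<open>V\<close> there too.\<close>

lemma strict_upper_contour_convex:
  assumes r: "r \<in> agents H \<tau> le" and W: "W \<in> H"
    and Y: "Y \<in> H" "(Y, W) \<notin> r" and Z: "Z \<in> H" "(Z, W) \<notin> r" and u: "0 \<le> u" "u \<le> 1"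
  shows "(\<lambda>\<omega>. (1 - u) * Y \<omega> + u * Z \<omega>) \<in> H \<and> ((\<lambda>\<omega>. (1 - u) * Y \<omega> + u * Z \<omega>), W) \<notin> r"
proof -
  let ?C = "\<lambda>\<omega>. (1 - u) * Y \<omega> + u * Z \<omega>"
  have total: "\<And>X Y. X \<in> H \<Longrightarrow> Y \<in> H \<Longrightarrow> (X, Y) \<in> r \<or> (Y, X) \<in> r"
    and tr: "trans r" and conv: "\<And>X. X \<in> H \<Longrightarrow> convex_funs {Z \<in> H. (X, Z) \<in> r}"
    using r by (auto simp: agents_def)
  have "\<exists>V\<in>{Y, Z}. (V, Y) \<in> r \<and> (V, Z) \<in> r"
    using total[OF Y(1) Z(1)] total[OF Y(1) Y(1)] total[OF Z(1) Z(1)] by blast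
  then obtain V where V: "V \<in> {Y, Z}" "(V, Y) \<in> r" "(V, Z) \<in> r" by blast
  then have "V \<in> H" "(V, W) \<notin> r" using Y Z by auto
  have "?C \<in> {Z \<in> H. (V, Z) \<in> r}"
    using conv[OF \<open>V \<in> H\<close>] V Y(1) Z(1) u unfolding convex_funs_def by blast
  with \<open>(V, W) \<notin> r\<close> tr show ?thesis by (auto dest: transD)
qed

lemma agent_supporting_functional:
  assumes r: "r \<in> agents (bounded_measurable F) (sup_topology F) le"
    and I: "module.subspace fun_scale I" "I \<subseteq> bounded_measurable F" "\<And>l. l \<in> I \<Longrightarrow> (l, \<lambda>_. 0) \<in> r"
    and R: "R \<in> bounded_measurable F" "(R, \<lambda>_. 0) \<notin> r"
    and le: "\<And>X Z c. X \<in> bounded_measurable F \<Longrightarrow> Z \<in> bounded_measurable F \<Longrightarrow> 0 < c \<Longrightarrow> le (\<lambda>_. 0) Z \<Longrightarrow>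
      le X (\<lambda>\<omega>. X \<omega> + c * Z \<omega>)"
  shows "\<exists>f. functional_on fun_scale (bounded_measurable F) f \<and> f R = 1 \<and>
    (\<forall>l\<in>I. f l = 0) \<and> (\<forall>Z\<in>bounded_measurable F. le (\<lambda>_. 0) Z \<longrightarrow> 0 \<le> f Z)"
proof -
  interpret vector_space fun_scale by (rule vector_space_fun_scale)
  let ?H = "bounded_measurable F"
  note V = subspace_bounded_measurable[of F]
  have I_lin: "(\<lambda>\<omega>. a * l \<omega> + b * m \<omega>) \<in> I" if "l \<in> I" "m \<in> I" for l m a b
    using subspace_add[OF I(1) subspace_scale[OF I(1) that(1), of a] subspace_scale[OF I(1) that(2), of b]]
    by (simp add: plus_fun_def)
  have I_0: "(\<lambda>_. 0) \<in> I" using subspace_0[OF I(1)] by (simp add: zero_fun_def)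
  \<comment> \<open>By completeness these are exactly the contracts strictly preferred to 0.\<close>
  define C where "C = {Z \<in> ?H. (Z, \<lambda>_. 0) \<notin> r}"
  define K where "K = {(\<lambda>\<omega>. t * Z \<omega> + l \<omega>) | t Z l. 0 < t \<and> Z \<in> C \<and> l \<in> I}"
  have K_I: "(\<lambda>\<omega>. t * Z \<omega> + l \<omega>) \<in> K" if "0 < t" "Z \<in> C" "l \<in> I" for t Z l
    using that unfolding K_def by blast
  have R_C: "R \<in> C" using R by (simp add: C_def)
  have "(\<lambda>\<omega>. t * Z \<omega> + l \<omega>) \<in> ?H" if "Z \<in> C" "l \<in> I" for t Z l
    using bounded_measurable_linear[of Z F l t 1] I(2) that by (auto simp: C_def)
  then have KH: "K \<subseteq> ?H" by (auto simp: K_def)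
  have zero_notin: "0 \<notin> K"
  proof
    assume "0 \<in> K"
    then obtain t Z l where tZl: "0 < t" "Z \<in> C" "l \<in> I" and eq: "0 = (\<lambda>\<omega>. t * Z \<omega> + l \<omega>)"
      by (auto simp: K_def)
    have "l \<omega> = - (t * Z \<omega>)" for \<omega> using fun_cong[OF eq, of \<omega>] by simp
    then have "Z \<omega> = (- 1 / t) * l \<omega>" for \<omega> using tZl(1) by simp
    then have "Z = (\<lambda>\<omega>. (- 1 / t) * l \<omega> + 0 * l \<omega>)" by (simp add: fun_eq_iff)
    also have "\<dots> \<in> I" using tZl(3) by (intro I_lin)
    finally show False using tZl(2) I(3) by (auto simp: C_def)
  qed
  have K_add: "X + Y \<in> K" if "X \<in> K" "Y \<in> K" for X Y
  proof -
    obtain s Z l where X: "0 < s" "Z \<in> C" "l \<in> I" "X = (\<lambda>\<omega>. s * Z \<omega> + l \<omega>)"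
      using \<open>X \<in> K\<close> by (auto simp: K_def)
    obtain t W m where Y: "0 < t" "W \<in> C" "m \<in> I" "Y = (\<lambda>\<omega>. t * W \<omega> + m \<omega>)"
      using \<open>Y \<in> K\<close> by (auto simp: K_def)
    \<comment> \<open>The weight for which \<open>s Z + t W\<close> is \<open>s + t\<close> times a
      convex combination of \<open>Z\<close> and \<open>W\<close>.\<close>
    let ?u = "t / (s + t)"
    let ?Z = "\<lambda>\<omega>. (1 - ?u) * Z \<omega> + ?u * W \<omega>"
    have u: "0 \<le> ?u" "?u \<le> 1" and t: "(s + t) * ?u = t" using X(1) Y(1) by simp_all
    then have s: "(s + t) * (1 - ?u) = s" by (simp only: right_diff_distrib) simp
    have "?Z \<in> ?H \<and> (?Z, \<lambda>_. 0) \<notin> r"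
      using X(2) Y(2)
      by (intro strict_upper_contour_convex[OF r bounded_measurable_zero _ _ _ _ u]) (simp_all add: C_def)
    then have "?Z \<in> C" by (simp add: C_def)
    moreover have "(\<lambda>\<omega>. 1 * l \<omega> + 1 * m \<omega>) \<in> I" using X(3) Y(3) by (rule I_lin)
    ultimately have "(\<lambda>\<omega>. (s + t) * ?Z \<omega> + (1 * l \<omega> + 1 * m \<omega>)) \<in> K"
      using X(1) Y(1) by (intro K_I) auto
    also have "(\<lambda>\<omega>. (s + t) * ?Z \<omega> + (1 * l \<omega> + 1 * m \<omega>)) = X + Y"
    proof
      fix \<omega>
      have "(s + t) * ?Z \<omega> = ((s + t) * (1 - ?u)) * Z \<omega> + ((s + t) * ?u) * W \<omega>"
        by (simp only: distrib_left mult.assoc)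
      then show "(s + t) * ?Z \<omega> + (1 * l \<omega> + 1 * m \<omega>) = (X + Y) \<omega>"
        unfolding s t X(4) Y(4) by simp
    qed
    finally show ?thesis .
  qed
  have K_scale: "fun_scale c X \<in> K" if "0 < c" "X \<in> K" for c X
  proof -
    obtain t Z l where X: "0 < t" "Z \<in> C" "l \<in> I" "X = (\<lambda>\<omega>. t * Z \<omega> + l \<omega>)"
      using \<open>X \<in> K\<close> by (auto simp: K_def)
    have "(\<lambda>\<omega>. (c * t) * Z \<omega> + (c * l \<omega> + 0 * l \<omega>)) \<in> K"
      by (rule K_I[OF mult_pos_pos[OF that(1) X(1)] X(2) I_lin[OF X(3) X(3)]])
    then show ?thesis by (simp add: X(4) distrib_left mult.assoc)
  qed
  \<comment> \<open>The functions \<open>R - X / (n + 1)\<close> converge uniformly to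
    \<open>R\<close>. If all were weakly below 0, lower semicontinuity would put \<open>R\<close>
    there as well; so one of them is in \<open>C\<close>, and multiplying it by \<open>n + 1\<close>
    gives an element of \<open>K\<close>.\<close>
  have unit: "\<exists>t. fun_scale t R - X \<in> K" if X: "X \<in> ?H" for X
  proof -
    let ?X = "\<lambda>n \<omega>. 1 * R \<omega> + (- 1 / real (Suc n)) * X \<omega>"
    have H: "?X n \<in> ?H" for n by (rule bounded_measurable_linear[OF R(1) X])
    obtain c where c: "0 \<le> c" "\<And>\<omega>. \<bar>X \<omega>\<bar> \<le> c" using bounded_measurable_abs_le[OF X] by blast
    have "uniform_limit (space F) ?X R sequentially"
    proof (rule uniform_limitI)
      fix e :: real assume "0 < e"
      have "(\<lambda>n. c / real (Suc n)) \<longlonglongrightarrow> 0" by (rule lim_const_over_n[THEN LIMSEQ_Suc])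
      then have "\<forall>\<^sub>F n in sequentially. c / real (Suc n) < e" using \<open>0 < e\<close> by (rule order_tendstoD)
      then show "\<forall>\<^sub>F n in sequentially. \<forall>\<omega>\<in>space F. dist (?X n \<omega>) (R \<omega>) < e"
      proof eventually_elim
        case (elim n)
        show ?case
        proof
          fix \<omega>
          have "dist (?X n \<omega>) (R \<omega>) = \<bar>X \<omega>\<bar> / real (Suc n)"
            by (simp add: dist_real_def abs_divide)
          also have "\<dots> \<le> c / real (Suc n)" by (intro divide_right_mono c(2)) simp
          finally show "dist (?X n \<omega>) (R \<omega>) < e" using elim by linarith
        qed
      qed
    qed
    then have "limitin (sup_topology F) ?X R sequentially"
      using limitin_sup_topology_iff[where Xn = ?X, OF H R(1)] by blast
    from agents_lower_semicontinuousD[OF r H R(1) bounded_measurable_zero this] R(2)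
    obtain n where "(?X n, \<lambda>_. 0) \<notin> r" by metis
    with H[of n] have "?X n \<in> C" by (simp add: C_def)
    then have "(\<lambda>\<omega>. real (Suc n) * ?X n \<omega> + 0) \<in> K" using I_0 by (intro K_I) auto
    also have "(\<lambda>\<omega>. real (Suc n) * ?X n \<omega> + 0) = fun_scale (real (Suc n)) R - X"
      by (simp add: fun_eq_iff right_diff_distrib del: of_nat_Suc)
    finally show ?thesis by (rule exI)
  qed
  have R_K: "R \<in> K" using K_I[OF zero_less_one R_C I_0] by simp
  obtain f where f: "functional_on fun_scale ?H f" "f R = 1" and f_K: "\<forall>X\<in>K. 0 \<le> f X"
    using positive_functional_exists[OF vector_space_fun_scale V KH zero_notin K_add K_scale R_K unit] by blast
  note lin = functional_on_linear[OF V f(1)]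
  \<comment> \<open>Neither a net trade nor an \<open>le\<close>-nonnegative contract has to lie in
    \<open>K\<close>. It is enough that it does after adding any positive multiple of
    \<open>R\<close>, as that multiple contributes only \<open>e\<close> to
    \<open>f\<close>.\<close>
  have nonneg: "0 \<le> f X" if X: "X \<in> ?H" and K: "\<And>e. 0 < e \<Longrightarrow> (\<lambda>\<omega>. e * R \<omega> + 1 * X \<omega>) \<in> K" for X
  proof (rule field_le_epsilon)
    fix e :: real assume "0 < e"
    from bspec[OF f_K K[OF this]] show "0 \<le> f X + e" using lin[OF R(1) X, of e 1] f(2) by simp
  qed
  show ?thesis
  proof (intro exI[of _ f] conjI ballI impI f)
    have I_nonneg: "0 \<le> f l" if "l \<in> I" for l
    proof (rule nonneg)
      show "(\<lambda>\<omega>. e * R \<omega> + 1 * l \<omega>) \<in> K" if "0 < e" for e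
        using K_I[OF that R_C \<open>l \<in> I\<close>] by simp
    qed (use that I(2) in blast)
    show "f l = 0" if l: "l \<in> I" for l
    proof -
      have "f (\<lambda>\<omega>. (- 1) * l \<omega> + 0 * l \<omega>) = - f l" using lin[of l l "- 1" 0] l I(2) by auto
      then show ?thesis using I_nonneg[OF l] I_nonneg[OF I_lin[OF l l, of "- 1" 0]] by simp
    qed
    show "0 \<le> f Z" if Z: "Z \<in> ?H" "le (\<lambda>_. 0) Z" for Z
    proof (rule nonneg[OF Z(1)])
      fix e :: real assume e: "0 < e"
      \<comment> \<open>\<open>e R + Z\<close> is \<open>e\<close> times \<open>?Y\<close>, and
        \<open>?Y\<close> dominates \<open>R\<close>, so it inherits from \<open>R\<close> that it
        is strictly preferred to 0.\<close>
      let ?Y = "\<lambda>\<omega>. R \<omega> + (1 / e) * Z \<omega>"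
      have Y: "?Y \<in> ?H" using bounded_measurable_linear[OF R(1) Z(1), of 1 "1 / e"] by simp
      have "le R ?Y" using e by (intro le R(1) Z) auto
      then have "(R, ?Y) \<in> r" using r R(1) Y by (auto simp: agents_def)
      moreover have "trans r" using r by (simp add: agents_def)
      ultimately have "?Y \<in> C" using R(2) Y unfolding C_def by (blast dest: transD)
      then have "(\<lambda>\<omega>. e * ?Y \<omega> + 0) \<in> K" using e I_0 by (intro K_I)
      then show "(\<lambda>\<omega>. e * R \<omega> + 1 * Z \<omega>) \<in> K" using e by (simp add: distrib_left)
    qed
  qed
qed

section \<open>Viability and martingale measures\<close>

text \<open>The order depends on \<open>M\<close> only through its polar sets; hence any
  \<open>Q\<close> with the same polar sets respects the same order.\<close>

lemma qs_le_iff_null: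
  assumes "\<And>P. P \<in> M \<Longrightarrow> prob_space P" "\<And>P. P \<in> M \<Longrightarrow> sets P = sets F"
    and X: "X \<in> bounded_measurable F" and Y: "Y \<in> bounded_measurable F"
  shows "qs_le M X Y \<longleftrightarrow> {\<omega> \<in> space F. Y \<omega> < X \<omega>} \<in> polar_sets F (measure ` M)"
proof -
  have [measurable]: "X \<in> borel_measurable F" "Y \<in> borel_measurable F"
    using X Y by (auto simp: bounded_measurable_def)
  have "measure P {\<omega> \<in> space P. X \<omega> \<le> Y \<omega>} = 1 \<longleftrightarrow> measure P {\<omega> \<in> space F. Y \<omega> < X \<omega>} = 0"
    if "P \<in> M" for P
  proof -
    interpret prob_space P by (rule assms(1)[OF that])
    note sets_P = assms(2)[OF that]
    note space_P = sets_eq_imp_space_eq[OF sets_P]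
    have "{\<omega> \<in> space P. X \<omega> \<le> Y \<omega>} \<in> events" unfolding sets_P space_P by measurable
    from prob_neg[OF this] show ?thesis by (simp add: not_le space_P)
  qed
  moreover have "{\<omega> \<in> space F. Y \<omega> < X \<omega>} \<in> sets F" by measurable
  ultimately show ?thesis by (auto simp: qs_le_def polar_sets_def)
qed

lemma qs_le_pointwise:
  assumes "\<And>P. P \<in> M \<Longrightarrow> prob_space P" "\<And>\<omega>. X \<omega> \<le> Y \<omega>"
  shows "qs_le M X Y"
  using assms by (simp add: qs_le_def prob_space.prob_space)

lemma indicator_relevant_contract:
  assumes "\<And>P. P \<in> M \<Longrightarrow> prob_space P" "\<And>P. P \<in> M \<Longrightarrow> sets P = sets F"
    and A: "A \<in> sets F" "A \<notin> polar_sets F (measure ` M)"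
  shows "indicator A \<in> relevant_contracts F M"
proof -
  obtain P where P: "P \<in> M" "measure P A > 0"
    using A by (auto simp: polar_sets_def zero_less_measure_iff)
  have "{\<omega> \<in> space P. indicator A \<omega> > (0 :: real)} = A"
    using A(1) sets.sets_into_space[of A P] assms(2)[OF P(1)] by (auto simp: indicator_def split: if_splits)
  with P(2) have "measure P {\<omega> \<in> space P. indicator A \<omega> > (0 :: real)} > 0" by simp
  moreover have "qs_le M (\<lambda>_. 0) (indicator A)" by (intro qs_le_pointwise assms(1)) auto
  ultimately show ?thesis
    using bounded_measurable_indicator[OF A(1)] P(1) unfolding relevant_contracts_def
    by (intro CollectI conjI bexI[of _ P])
qed

text \<open>\<open>{R > 0}\<close> is the countable union of the events
  \<open>{R >= 1 / (n + 1)}\<close>, and countable additivity of \<open>P\<close> forbids all of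
  them to be null.\<close>

lemma positive_part_not_null:
  assumes "finite_measure P" "sets P = sets F" "R \<in> borel_measurable F"
    and pos: "measure P {\<omega> \<in> space P. R \<omega> > 0} > 0"
  shows "\<exists>e>0. measure P {\<omega> \<in> space F. (e :: real) \<le> R \<omega>} > 0"
proof (rule ccontr)
  assume none: "\<not> ?thesis"
  interpret finite_measure P by fact
  note space_P = sets_eq_imp_space_eq[OF assms(2)]
  have R[measurable]: "R \<in> borel_measurable P" using assms(2,3) by (simp cong: measurable_cong_sets)
  let ?A = "\<lambda>n. {\<omega> \<in> space P. inverse (real (Suc n)) \<le> R \<omega>}"
  have "?A n \<in> null_sets P" for n
  proof
    show "emeasure P (?A n) = 0"
      using none[unfolded not_ex, rule_format, of "inverse (real (Suc n))"]
      by (simp add: space_P emeasure_eq_measure zero_less_measure_iff)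
  qed measurable
  then have "(\<Union>n. ?A n) \<in> null_sets P" by (rule null_sets_UN)
  also have "(\<Union>n. ?A n) = {\<omega> \<in> space P. R \<omega> > 0}"
  proof (intro set_eqI iffI)
    fix \<omega> assume \<omega>: "\<omega> \<in> {\<omega> \<in> space P. R \<omega> > 0}"
    then have "0 < R \<omega>" by simp
    from reals_Archimedean[OF this] obtain n where "inverse (real (Suc n)) < R \<omega>" by blast
    with \<omega> have "\<omega> \<in> ?A n" by simp
    then show "\<omega> \<in> (\<Union>n. ?A n)" by blast
  next
    fix \<omega> assume "\<omega> \<in> (\<Union>n. ?A n)"
    then obtain n where n: "\<omega> \<in> space P" "inverse (real (Suc n)) \<le> R \<omega>" by blast
    have "0 < inverse (real (Suc n))" by simp
    then have "0 < R \<omega>" using n(2) by (rule less_le_trans)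
    with n(1) show "\<omega> \<in> {\<omega> \<in> space P. R \<omega> > 0}" by simp
  qed
  finally show False using pos by (simp add: null_sets_def measure_def)
qed

lemma subspace_net_trades: "module.subspace fun_scale (net_trades F T Fil (S :: nat \<Rightarrow> 'w \<Rightarrow> real ^ 'j))"
proof (rule subspace_fun_scaleI)
  have "(\<lambda>_. 0) \<in> net_trades F T Fil S"
    unfolding net_trades_def
    by (auto simp: bounded_measurable_zero intro!: exI[of _ "\<lambda>_ _. 0"])
  then show "0 \<in> net_trades F T Fil S" by (simp add: zero_fun_def)
next
  fix l m :: "'w \<Rightarrow> real" and a b :: real
  assume "l \<in> net_trades F T Fil S" "m \<in> net_trades F T Fil S"
  then obtain H G :: "nat \<Rightarrow> 'w \<Rightarrow> real ^ 'j" where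
    l: "l \<in> bounded_measurable F" "\<forall>t\<in>{1..T}. H t \<in> borel_measurable (Fil (t - 1))"
      "\<forall>\<omega>\<in>space F. l \<omega> = (\<Sum>t=1..T. H t \<omega> \<bullet> (S t \<omega> - S (t - 1) \<omega>))" and
    m: "m \<in> bounded_measurable F" "\<forall>t\<in>{1..T}. G t \<in> borel_measurable (Fil (t - 1))"
      "\<forall>\<omega>\<in>space F. m \<omega> = (\<Sum>t=1..T. G t \<omega> \<bullet> (S t \<omega> - S (t - 1) \<omega>))"
    by (auto simp: net_trades_def)
  let ?K = "\<lambda>t \<omega>. a *\<^sub>R H t \<omega> + b *\<^sub>R G t \<omega>"
  have "\<forall>t\<in>{1..T}. ?K t \<in> borel_measurable (Fil (t - 1))" 
    using l(2) m(2) by (intro ballI borel_measurable_add borel_measurable_scaleR) auto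
  moreover have "\<forall>\<omega>\<in>space F. a * l \<omega> + b * m \<omega> = (\<Sum>t=1..T. ?K t \<omega> \<bullet> (S t \<omega> - S (t - 1) \<omega>))"
    using l(3) m(3) by (simp add: inner_add_left sum.distrib sum_distrib_left)
  ultimately show "(\<lambda>\<omega>. a * l \<omega> + b * m \<omega>) \<in> net_trades F T Fil S"
    using bounded_measurable_linear[OF l(1) m(1)] unfolding net_trades_def
    by (intro CollectI conjI exI[of _ ?K])
qed

section \<open>From one agent to one martingale measure\<close>

lemma fa_martingale_measure_charging:
  assumes prob: "\<And>P. P \<in> M \<Longrightarrow> prob_space P" and sets_M: "\<And>P. P \<in> M \<Longrightarrow> sets P = sets F"
    and I: "module.subspace fun_scale I" "I \<subseteq> bounded_measurable F"
    and r: "r \<in> agents (bounded_measurable F) (sup_topology F) (qs_le M)" "\<And>l. l \<in> I \<Longrightarrow> (l, \<lambda>_. 0) \<in> r"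
    and A: "A \<in> sets F" "(indicator A, \<lambda>_. 0) \<notin> r"
  shows "\<exists>\<phi> \<in> fa_martingale_measures F I. (\<forall>B \<in> polar_sets F (measure ` M). \<phi> B = 0) \<and> \<phi> A > 0"
proof -
  let ?H = "bounded_measurable F"
  note V = subspace_bounded_measurable[of F]
  note ind = bounded_measurable_indicator[of _ F]
  have le: "qs_le M X (\<lambda>\<omega>. X \<omega> + c * Z \<omega>)" if "0 < c" "qs_le M (\<lambda>_. 0) Z" for X Z c
    using that by (simp add: qs_le_def zero_le_mult_iff)
  obtain f where f: "functional_on fun_scale ?H f" "f (indicator A) = 1" "\<forall>l\<in>I. f l = 0"
    and "\<forall>Z\<in>?H. qs_le M (\<lambda>_. 0) Z \<longrightarrow> 0 \<le> f Z"
    using agent_supporting_functional[OF r(1) I r(2) ind[OF A(1)] A(2) le] by blast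
  then have f_qs: "0 \<le> f Z" if "Z \<in> ?H" "qs_le M (\<lambda>_. 0) Z" for Z using that by blast
  note lin = functional_on_linear[OF V f(1)]
  have f_pos: "0 \<le> f Z" if "Z \<in> ?H" "\<And>\<omega>. 0 \<le> Z \<omega>" for Z
    using that by (intro f_qs qs_le_pointwise prob)
  let ?c = "f (indicator (space F))"
  \<comment> \<open>The indicator of the space dominates that of \<open>A\<close>, where
    \<open>f\<close> is 1. The normalizing constant is therefore at least 1, and dividing by it is
    safe.\<close>
  have "0 \<le> f (\<lambda>\<omega>. 1 * indicator (space F) \<omega> + (- 1) * indicator A \<omega>)"
    using A(1) sets.sets_into_space
    by (intro f_pos bounded_measurable_linear ind) (auto simp: indicator_def)
  then have c: "1 \<le> ?c" using lin[OF ind[OF sets.top] ind[OF A(1)], of 1 "- 1"] f(2) by simp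
  let ?g = "\<lambda>X. f X / ?c"
  have g: "functional_on fun_scale ?H ?g"
    using f(1) by (simp add: functional_on_def add_divide_distrib)
  have g_pos: "0 \<le> ?g X" if "X \<in> ?H" "\<forall>\<omega>. 0 \<le> X \<omega>" for X
    using f_pos[of X] that c by (intro divide_nonneg_nonneg) auto
  have g_one: "?g (indicator (space F)) = 1" using c by simp
  let ?\<phi> = "\<lambda>B. ?g (indicator B)"
  have \<phi>: "fa_prob F ?\<phi>"
    by (rule fa_prob_of_positive_functional(1)[OF g _ g_one]) (rule g_pos)
  have \<phi>_integral: "fa_integral F ?\<phi> X = ?g X" if "X \<in> ?H" for X
    by (rule fa_prob_of_positive_functional(2)[OF g _ g_one that]) (rule g_pos)
  have "?\<phi> B = 0" if B: "B \<in> polar_sets F (measure ` M)" for B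
  proof -
    have BF: "B \<in> sets F" using B by (simp add: polar_sets_def)
    \<comment> \<open>The negative indicator of \<open>B\<close>: it is below 0 only on the polar
      set \<open>B\<close>, so it is quasi-surely nonnegative and \<open>f\<close> must be
      nonnegative on it.\<close>
    let ?Z = "\<lambda>\<omega>. (- 1) * indicator B \<omega> + 0 * indicator B \<omega> :: real"
    have Z: "?Z \<in> ?H" by (intro bounded_measurable_linear ind BF)
    have "{\<omega> \<in> space F. ?Z \<omega> < 0} = B" using sets.sets_into_space[OF BF] by (auto simp: indicator_def)
    then have "qs_le M (\<lambda>_. 0) ?Z"
      using qs_le_iff_null[OF prob sets_M bounded_measurable_zero Z] B by simp
    from f_qs[OF Z this] lin[OF ind[OF BF] ind[OF BF], of "- 1" 0] have "f (indicator B) \<le> 0" by simp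
    moreover have "0 \<le> f (indicator B)" by (intro f_pos ind BF) simp
    ultimately have "f (indicator B) = 0" by (rule antisym)
    then show ?thesis by simp
  qed
  moreover have "?\<phi> \<in> fa_martingale_measures F I"
    unfolding fa_martingale_measures_def
  proof (intro CollectI conjI ballI \<phi>)
    fix l assume "l \<in> I"
    from \<phi>_integral[OF subsetD[OF I(2) this]] have "fa_integral F ?\<phi> l = ?g l" .
    with \<open>l \<in> I\<close> f(3) show "fa_integral F ?\<phi> l = 0" by simp
  qed
  moreover have "?\<phi> A > 0" using c f(2) by simp
  ultimately show ?thesis by (intro bexI[of _ ?\<phi>] conjI ballI)
qed

section \<open>The two implications\<close>

lemma viable_if_fa_martingale_measures:
  assumes prob: "\<And>P. P \<in> M \<Longrightarrow> prob_space P" and sets_M: "\<And>P. P \<in> M \<Longrightarrow> sets P = sets F"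
    and I: "I \<subseteq> bounded_measurable F"
    and Q: "Q \<subseteq> fa_martingale_measures F I" "polar_sets F Q = polar_sets F (measure ` M)"
  shows "viable (bounded_measurable F) (sup_topology F) (qs_le M) I (relevant_contracts F M)"
proof -
  let ?H = "bounded_measurable F"
  let ?r = "\<lambda>\<phi>. {(X, Y). X \<in> ?H \<and> Y \<in> ?H \<and> fa_integral F \<phi> X \<le> fa_integral F \<phi> Y}"
  have fa: "fa_prob F \<phi>" if "\<phi> \<in> Q" for \<phi> using that Q(1) by (auto simp: fa_martingale_measures_def)
  have null: "{\<omega> \<in> space F. Y \<omega> < X \<omega>} \<in> sets F" "\<phi> {\<omega> \<in> space F. Y \<omega> < X \<omega>} = 0"
    if "\<phi> \<in> Q" "X \<in> ?H" "Y \<in> ?H" "qs_le M X Y" for \<phi> X Y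
  proof -
    have "{\<omega> \<in> space F. Y \<omega> < X \<omega>} \<in> polar_sets F Q"
      using qs_le_iff_null[OF prob sets_M that(2,3)] that(4) unfolding Q(2) by simp
    then show "{\<omega> \<in> space F. Y \<omega> < X \<omega>} \<in> sets F" "\<phi> {\<omega> \<in> space F. Y \<omega> < X \<omega>} = 0"
      using that(1) unfolding polar_sets_def by blast+
  qed
  have agent: "?r \<phi> \<in> agents ?H (sup_topology F) (qs_le M)" if "\<phi> \<in> Q" for \<phi>
  proof (rule expectation_preference_agent[OF fa[OF that]])
    fix X Y assume XY: "X \<in> ?H" "Y \<in> ?H" "qs_le M X Y"
    show "fa_integral F \<phi> X \<le> fa_integral F \<phi> Y"
      by (rule fa_integral_mono_null[OF fa[OF that] XY(1,2) null[OF that XY]]) auto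
  qed
  have trade: "(l, \<lambda>_. 0) \<in> ?r \<phi>" if "\<phi> \<in> Q" "l \<in> I" for \<phi> l
  proof -
    have "l \<in> ?H" using that(2) I by blast
    moreover have "fa_integral F \<phi> l = 0" using that Q(1) unfolding fa_martingale_measures_def by blast
    ultimately show ?thesis
      using bounded_measurable_zero fa_integral_zero[OF fa[OF that(1)]] by simp
  qed
  have relevant: "\<exists>\<phi>\<in>Q. (\<lambda>_. 0, R) \<in> ?r \<phi> \<and> (R, \<lambda>_. 0) \<notin> ?r \<phi>" if R: "R \<in> relevant_contracts F M" for R
  proof -
    from R have RH: "R \<in> ?H" and R_ge: "qs_le M (\<lambda>_. 0) R"
      and "\<exists>P\<in>M. measure P {\<omega> \<in> space P. R \<omega> > 0} > 0" by (simp_all add: relevant_contracts_def)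
    then obtain P where P: "P \<in> M" "measure P {\<omega> \<in> space P. R \<omega> > 0} > 0" by blast
    have R_meas[measurable]: "R \<in> borel_measurable F" using RH by (simp add: bounded_measurable_def)
    from positive_part_not_null[OF prob_space.finite_measure[OF prob[OF P(1)]] sets_M[OF P(1)] R_meas P(2)]
    obtain e where e: "e > 0" and pos: "measure P {\<omega> \<in> space F. e \<le> R \<omega>} > 0"
      by (elim exE conjE)
    let ?A = "{\<omega> \<in> space F. e \<le> R \<omega>}"
    have A: "?A \<in> sets F" by measurable
    have "?A \<notin> polar_sets F Q"
    proof
      assume "?A \<in> polar_sets F Q"
      then have "measure P ?A = 0" using P(1) unfolding Q(2) by (simp add: polar_sets_def)
      with pos show False by simp
    qed
    with A obtain \<phi> where \<phi>: "\<phi> \<in> Q" "\<phi> ?A \<noteq> 0" by (auto simp: polar_sets_def)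
    have "0 \<le> \<phi> ?A" using A fa[OF \<phi>(1)] by (simp add: fa_prob_def)
    with e \<phi>(2) have "0 < e * \<phi> ?A" by simp
    also have "e * \<phi> ?A = simple_fa_integral F \<phi> (\<lambda>\<omega>. e * indicator ?A \<omega>)"
      by (rule simple_fa_integral_indicator[OF fa[OF \<phi>(1)] A, symmetric])
    \<comment> \<open>Markov's inequality: \<open>e * indicator ?A\<close> is below \<open>R\<close>
      except possibly on \<open>{R < 0}\<close>, which is polar and hence null for \<phi>.\<close>
    also have "\<dots> \<le> fa_integral F \<phi> R"
    proof (rule simple_fa_integral_le_fa_integral[OF fa[OF \<phi>(1)] RH _ null[OF \<phi>(1) bounded_measurable_zero RH R_ge]])
      show "simple_function F (\<lambda>\<omega>. e * indicator ?A \<omega>)" using A by (intro simple_function_mult) auto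
    qed (auto simp: indicator_def)
    finally show ?thesis
      using \<phi>(1) RH bounded_measurable_zero fa_integral_zero[OF fa[OF \<phi>(1)]] by (intro bexI[of _ \<phi>]) auto
  qed
  show ?thesis
    unfolding viable_def
  proof (intro exI[of _ "?r ` Q"] conjI ballI)
    show "?r ` Q \<subseteq> agents ?H (sup_topology F) (qs_le M)" using agent by (rule image_subsetI)
    show "(l, \<lambda>_. 0) \<in> r" if "r \<in> ?r ` Q" "l \<in> I" for r l
      using that(1) trade[OF _ that(2)] by (elim imageE) (simp only:)
    show "\<exists>r\<in>?r ` Q. (\<lambda>_. 0, R) \<in> r \<and> (R, \<lambda>_. 0) \<notin> r" if "R \<in> relevant_contracts F M" for R
      using relevant[OF that] by (elim bexE) (rule bexI[OF _ imageI])
  qed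
qed

lemma fa_martingale_measures_if_viable:
  assumes prob: "\<And>P. P \<in> M \<Longrightarrow> prob_space P" and sets_M: "\<And>P. P \<in> M \<Longrightarrow> sets P = sets F"
    and I: "module.subspace fun_scale I" "I \<subseteq> bounded_measurable F"
    and viable: "viable (bounded_measurable F) (sup_topology F) (qs_le M) I (relevant_contracts F M)"
  shows "\<exists>Q \<subseteq> fa_martingale_measures F I. polar_sets F Q = polar_sets F (measure ` M)"
proof -
  \<comment> \<open>The largest candidate: vanishing on the polar sets of \<open>M\<close> is built
    in. It remains to charge each non-polar \<open>A\<close>, whose indicator is a relevant contract
    and so is strictly preferred to 0 by some agent.\<close>
  define Q where "Q = {\<phi> \<in> fa_martingale_measures F I. \<forall>B \<in> polar_sets F (measure ` M). \<phi> B = 0}"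
  from viable obtain U where U: "U \<subseteq> agents (bounded_measurable F) (sup_topology F) (qs_le M)"
      and U_I: "\<forall>r\<in>U. \<forall>l\<in>I. (l, \<lambda>_. 0) \<in> r"
      and U_R: "\<forall>R\<in>relevant_contracts F M. \<exists>r\<in>U. (\<lambda>_. 0, R) \<in> r \<and> (R, \<lambda>_. 0) \<notin> r"
    unfolding viable_def by (elim exE conjE)
  have "A \<notin> polar_sets F Q" if A: "A \<in> sets F" "A \<notin> polar_sets F (measure ` M)" for A
  proof -
    obtain r where r: "r \<in> U" "(indicator A, \<lambda>_. 0) \<notin> r"
      using bspec[OF U_R indicator_relevant_contract[OF prob sets_M A]] by blast
    have "r \<in> agents (bounded_measurable F) (sup_topology F) (qs_le M)" using U r(1) by blast
    from fa_martingale_measure_charging[OF prob sets_M I this bspec[OF bspec[OF U_I r(1)]] A(1) r(2)]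
    have "\<exists>\<phi>\<in>Q. \<phi> A > 0" by (auto simp: Q_def)
    then obtain \<phi> where \<phi>: "\<phi> \<in> Q" "\<phi> A > 0" by blast
    show ?thesis
    proof
      assume "A \<in> polar_sets F Q"
      then have "\<phi> A = 0" using \<phi>(1) unfolding polar_sets_def by blast
      with \<phi>(2) show False by simp
    qed
  qed
  then have "polar_sets F Q \<subseteq> polar_sets F (measure ` M)" by (auto simp: polar_sets_def)
  moreover have "polar_sets F (measure ` M) \<subseteq> polar_sets F Q" by (auto simp: Q_def polar_sets_def)
  moreover have "Q \<subseteq> fa_martingale_measures F I" by (auto simp: Q_def)
  ultimately show ?thesis by blast
qed

theorem proposition3p5:
  fixes F :: "'w measure"
    and M :: "'w measure set"
    and T :: nat
    and Fil :: "nat \<Rightarrow> 'w measure"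
    and S :: "nat \<Rightarrow> 'w \<Rightarrow> real ^ 'j"
  assumes prob: "\<And>P. P \<in> M \<Longrightarrow> prob_space P"
    and sets_M: "\<And>P. P \<in> M \<Longrightarrow> sets P = sets F"
    and T_pos: "T \<ge> 1"
    and Fil_sub: "\<And>t. t \<le> T \<Longrightarrow> subalgebra F (Fil t)"
    and Fil_mono: "\<And>s t. s \<le> t \<Longrightarrow> t \<le> T \<Longrightarrow> sets (Fil s) \<subseteq> sets (Fil t)"
    and adapted: "\<And>t. t \<le> T \<Longrightarrow> S t \<in> borel_measurable (Fil t)"
    and S_nonneg: "\<And>t \<omega> j. t \<le> T \<Longrightarrow> \<omega> \<in> space F \<Longrightarrow> 0 \<le> S t \<omega> $ j"
  shows "viable (bounded_measurable F) (sup_topology F) (qs_le M)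
           (net_trades F T Fil S) (relevant_contracts F M)
         \<longleftrightarrow> (\<exists>Q. Q \<subseteq> fa_martingale_measures F (net_trades F T Fil S) \<and>
                  polar_sets F Q = polar_sets F (measure ` M))"
proof -
  note I = subspace_net_trades[of F T Fil S]
  have I_bounded: "net_trades F T Fil S \<subseteq> bounded_measurable F" by (auto simp: net_trades_def)
  show ?thesis
  proof
    assume "viable (bounded_measurable F) (sup_topology F) (qs_le M)
      (net_trades F T Fil S) (relevant_contracts F M)"
    from fa_martingale_measures_if_viable[OF prob sets_M I I_bounded this]
    show "\<exists>Q. Q \<subseteq> fa_martingale_measures F (net_trades F T Fil S) \<and>
      polar_sets F Q = polar_sets F (measure ` M)" .
  next
    assume "\<exists>Q. Q \<subseteq> fa_martingale_measures F (net_trades F T Fil S) \<and>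
      polar_sets F Q = polar_sets F (measure ` M)"
    then obtain Q where Q: "Q \<subseteq> fa_martingale_measures F (net_trades F T Fil S)"
        "polar_sets F Q = polar_sets F (measure ` M)" by (elim exE conjE)
    from viable_if_fa_martingale_measures[OF prob sets_M I_bounded Q]
    show "viable (bounded_measurable F) (sup_topology F) (qs_le M)
      (net_trades F T Fil S) (relevant_contracts F M)" .
  qed
qed

end
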